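(* There exist universal constants $0<c\le C<\infty$ such that for every integer $n\ge2$, every irreducible $n\times n$ doubly stochastic matrix $P$, and every integer $m\ge1$, $$c\,\lambda(P)\left(1+\frac mn\right)^{-2}\ \le\ \lambda\bigl(\mathrm{zrp}(P,\mathbf 1,m)\bigr)\ \le\ C\,\lambda(P)\left(1+\frac mn\right)^{-2}.$$
   Context: Let $V$ be the index set of $P$, $|V|=n$, and $\mathbb Z_+=\{0,1,2,\dots\}$. The state space is $\Omega=\{\eta\in\mathbb Z_+^V\colon \sum_{x\in V}\eta(x)=m\}$; $(\delta_x)_{x\in V}$ is the canonical basis of $\mathbb R^V$. The rate-one zero-range process $\mathrm{zrp}(P,\mathbf 1,m)$ is the continuous-time Markov chain on $\Omega$ with generator $$(\mathcal L f)(\eta)=\sum_{(x,y)\in V^2} \mathbf 1_{(\eta(x)\ge1)}\,P(x,y)\,\bigl(f(\eta+\delta_y-\delta_x)-f(\eta)\bigr)$$ (terms with $\eta(x)=0$ being zero). Its stationary law $\mu$ is the uniform law on $\Omega$. Its Dirichlet form is $\mathcal E(f,g)=-\sum_{\eta\in\Omega}\mu(\eta)f(\eta)(\mathcal L g)(\eta)$, and its Poincaré constant is $\lambda(\mathrm{zrp}(P,\mathbf 1,m))=\min_f \mathcal E(f,f)/\mathrm{Var}_\mu(f)$, over non-constant $f\colon\Omega\to\mathbb R$. With $\pi$ the uniform law on $V$ (the invariant law of $P$), the Dirichlet form of $P$ is $\mathcal E_P(\phi,\psi)=\sum_{x\in V}\pi(x)\phi(x)((I-P)\psi)(x)$, and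 the Poincaré constant of $P$ is $\lambda(P)=\min_\phi \mathcal E_P(\phi,\phi)/\mathrm{Var}_\pi(\phi)$, over non-constant $\phi\colon V\to\mathbb R$. No reversibility is assumed. *)

theory Defs
  imports "HOL-Probability.Probability" "Jordan_Normal_Form.Matrix"
begin

unbundle no vec_syntax

definition doubly_stochastic :: "nat \<Rightarrow> real mat \<Rightarrow> bool" where
  "doubly_stochastic n P \<longleftrightarrow>
     P \<in> carrier_mat n n \<and>
     (\<forall>x<n. \<forall>y<n. 0 \<le> P $$ (x, y)) \<and>
     (\<forall>x<n. (\<Sum>y<n. P $$ (x, y)) = 1) \<and>
     (\<forall>y<n. (\<Sum>x<n. P $$ (x, y)) = 1)"

definition irreducible_matrix :: "nat \<Rightarrow> real mat \<Rightarrow> bool" where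
  "irreducible_matrix n P \<longleftrightarrow> (\<forall>x<n. \<forall>y<n. \<exists>k. 0 < (P ^\<^sub>m k) $$ (x, y))"

text \<open>The infimum below is the minimum in the finite irreducible settings it is applied to.
  Only the values of \<open>f\<close> on the finite state space \<open>S\<close> matter there.\<close>

definition poincare_constant ::
  "'s set \<Rightarrow> 's pmf \<Rightarrow> (('s \<Rightarrow> real) \<Rightarrow> ('s \<Rightarrow> real) \<Rightarrow> real) \<Rightarrow> real" where
  "poincare_constant S \<mu> E = (INF f \<in> {f. \<not> f constant_on S}. E f f / measure_pmf.variance \<mu> f)"

definition chain_law :: "nat \<Rightarrow> nat pmf" where
  "chain_law n = pmf_of_set {..<n}"

definition chain_dirichlet :: "nat \<Rightarrow> real mat \<Rightarrow> (nat \<Rightarrow> real) \<Rightarrow> (nat \<Rightarrow> real) \<Rightarrow> real" where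
  "chain_dirichlet n P \<phi> \<psi> =
     (\<Sum>x<n. pmf (chain_law n) x * \<phi> x * (((1\<^sub>m n - P) *\<^sub>v vec n \<psi>) $ x))"

definition chain_poincare :: "nat \<Rightarrow> real mat \<Rightarrow> real" where
  "chain_poincare n P = poincare_constant {..<n} (chain_law n) (chain_dirichlet n P)"

definition zrp_states :: "nat \<Rightarrow> nat \<Rightarrow> nat vec set" where
  "zrp_states n m = {\<eta> \<in> carrier_vec n. (\<Sum>x<n. \<eta> $ x) = m}"

text \<open>Subtraction of natural numbers is truncated, but the guard \<open>\<eta> $ x \<ge> 1\<close> makes
  \<open>\<eta> + unit_vec n y - unit_vec n x\<close> the genuine difference; for \<open>x = y\<close> it is \<open>\<eta>\<close>.\<close>

definition zrp_generator :: "nat \<Rightarrow> real mat \<Rightarrow> (nat vec \<Rightarrow> real) \<Rightarrow> nat vec \<Rightarrow> real" where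
  "zrp_generator n P f \<eta> =
     (\<Sum>(x, y) \<in> {..<n} \<times> {..<n}.
        if \<eta> $ x \<ge> 1
        then P $$ (x, y) * (f (\<eta> + unit_vec n y - unit_vec n x) - f \<eta>) else 0)"

definition zrp_law :: "nat \<Rightarrow> nat \<Rightarrow> nat vec pmf" where
  "zrp_law n m = pmf_of_set (zrp_states n m)"

definition zrp_dirichlet ::
  "nat \<Rightarrow> real mat \<Rightarrow> nat \<Rightarrow> (nat vec \<Rightarrow> real) \<Rightarrow> (nat vec \<Rightarrow> real) \<Rightarrow> real" where
  "zrp_dirichlet n P m f g =
     - (\<Sum>\<eta> \<in> zrp_states n m. pmf (zrp_law n m) \<eta> * f \<eta> * zrp_generator n P g \<eta>)"

definition zrp_poincare :: "nat \<Rightarrow> real mat \<Rightarrow> nat \<Rightarrow> real" where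
  "zrp_poincare n P m = poincare_constant (zrp_states n m) (zrp_law n m) (zrp_dirichlet n P m)"

lemma zrp_states_jump:
  assumes "\<eta> \<in> zrp_states n m" "x < n" "y < n" "\<eta> $ x \<ge> 1"
  shows "\<eta> + unit_vec n y - unit_vec n x \<in> zrp_states n m"
proof -
  let ?\<zeta> = "\<eta> + unit_vec n y - unit_vec n x"
  have "(\<Sum>z<n. ?\<zeta> $ z) + (\<Sum>z<n. unit_vec n x $ z) = (\<Sum>z<n. \<eta> $ z) + (\<Sum>z<n. unit_vec n y $ z)"
    unfolding sum.distrib[symmetric] using assms
    by (intro sum.cong) (auto simp: zrp_states_def)
  moreover have "(\<Sum>z<n. unit_vec n w $ z) = (1::nat)" if "w < n" for w
    using that by (simp add: unit_vec_def if_distrib cong: if_cong)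
  ultimately show ?thesis
    using assms by (auto simp: zrp_states_def)
qed

lemma finite_zrp_states: "finite (zrp_states n m)"
proof (rule finite_subset)
  show "zrp_states n m \<subseteq> vec_of_list ` {xs. set xs \<subseteq> {..m} \<and> length xs = n}"
  proof
    fix \<eta> assume *: "\<eta> \<in> zrp_states n m"
    then have "\<eta> $ x \<le> m" if "x < n" for x
      using that member_le_sum[of x "{..<n}" "\<lambda>x. \<eta> $ x"] by (auto simp: zrp_states_def)
    with * have "set (list_of_vec \<eta>) \<subseteq> {..m}" "length (list_of_vec \<eta>) = n"
      by (auto simp: zrp_states_def set_list_of_vec vec_set_def)
    then show "\<eta> \<in> vec_of_list ` {xs. set xs \<subseteq> {..m} \<and> length xs = n}"
      by (intro image_eqI[of _ _ "list_of_vec \<eta>"]) (auto simp: vec_list)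
  qed
qed (simp add: finite_lists_length_eq)

lemma zrp_states_nonempty:
  assumes "n \<ge> 1"
  shows "zrp_states n m \<noteq> {}"
proof -
  have "vec n (\<lambda>x. if x = 0 then m else 0) \<in> zrp_states n m"
    using assms by (simp add: zrp_states_def)
  then show ?thesis by blast
qed

end

theory Submission
  imports Defs
begin

text \<open>Writing a configuration with \<open>m\<close> particles as \<open>\<xi> + \<delta>\<^sub>x\<close>, with \<open>\<xi>\<close> a configuration of \<open>m - 1\<close>
  particles, turns the Dirichlet form of the zero-range process into a sum over \<open>\<xi>\<close> of Dirichlet forms of
  \<open>P\<close> evaluated at \<open>x \<mapsto> f (\<xi> + \<delta>\<^sub>x)\<close>. The Poincare inequality of \<open>P\<close> then reduces the lower bound to
  the mean-field process \<open>P(x, y) = 1 / n\<close>, and linear functions \<open>\<eta> \<mapsto> \<Sum>\<^sub>x \<phi>(x) \<eta>(x)\<close> give the upper bound.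

  In the mean-field case let \<open>A\<close> be minus the generator and \<open>G(\<xi>, x)\<close> the centering in \<open>x\<close> of
  \<open>f (\<xi> + \<delta>\<^sub>x)\<close>. Since \<open>\<Sum>\<^sub>x G(\<xi>, x) = 0\<close>, a Bochner computation shows that \<open>\<parallel>A f\<parallel>\<^sup>2\<close> is the sum over \<open>x\<close>
  of the Dirichlet form of \<open>G(\<cdot>, x)\<close> for \<open>m - 1\<close> particles plus the mass of \<open>G(\<cdot>, x)\<^sup>2\<close> on \<open>{\<xi>(x) = 0}\<close>.
  A Hardy inequality bounds each term from below by a multiple of \<open>(1 + m / n)\<^sup>-\<^sup>2\<close> times the mass of
  \<open>G(\<cdot>, x)\<^sup>2\<close>, so that \<open>\<parallel>A f\<parallel>\<^sup>2\<close> dominates the Dirichlet form of \<open>f\<close>, which is equivalent to a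
  spectral gap.\<close>

section \<open>Adding and removing a particle\<close>

lemma add_unit_vec_in_zrp_states:
  assumes "\<xi> \<in> zrp_states n M" "x < n"
  shows "\<xi> + unit_vec n x \<in> zrp_states n (Suc M)"
proof -
  have "(\<Sum>z<n. (\<xi> + unit_vec n x) $ z) = (\<Sum>z<n. \<xi> $ z + (if z = x then 1 else 0))"
    using assms by (intro sum.cong) (auto simp: zrp_states_def)
  then show ?thesis
    using assms by (auto simp: zrp_states_def sum.distrib)
qed

lemma diff_unit_vec_in_zrp_states:
  assumes "\<eta> \<in> zrp_states n (Suc M)" "x < n" "\<eta> $ x \<ge> 1"
  shows "\<eta> - unit_vec n x \<in> zrp_states n M"
proof -
  have "(\<Sum>z<n. (\<eta> - unit_vec n x) $ z + (if z = x then 1 else 0)) = (\<Sum>z<n. \<eta> $ z)"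
    using assms by (intro sum.cong) (auto simp: zrp_states_def)
  then have "(\<Sum>z<n. (\<eta> - unit_vec n x) $ z) = M"
    using assms unfolding sum.distrib by (simp add: zrp_states_def del: index_minus_vec)
  then show ?thesis
    using assms by (simp add: zrp_states_def del: index_minus_vec)
qed

lemma zrp_states_dim: "\<eta> \<in> zrp_states n m \<Longrightarrow> dim_vec \<eta> = n"
  by (simp add: zrp_states_def)

lemma add_diff_unit_vec:
  "\<xi> \<in> zrp_states n M \<Longrightarrow> x < n \<Longrightarrow> \<xi> + unit_vec n x + unit_vec n y - unit_vec n x = \<xi> + unit_vec n y"
  by (intro eq_vecI) (auto simp: zrp_states_dim)

text \<open>The guard matters for \<open>x = z\<close>: there truncated subtraction at an empty site
  could make the two sides differ.\<close>

lemma add_unit_vec_commute_jump: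
  fixes \<xi> :: "nat vec"
  assumes "\<xi> \<in> zrp_states n M" "z < n" "\<xi> $ z \<ge> 1"
  shows "\<xi> + unit_vec n x + unit_vec n w - unit_vec n z = \<xi> + unit_vec n w - unit_vec n z + unit_vec n x"
  using assms by (intro eq_vecI) (auto simp: zrp_states_dim)

text \<open>Removing a particle at \<open>x\<close> is a bijection from the configurations with
  \<open>\<eta> $ x \<ge> 1\<close> onto those with one particle fewer. Through this change of
  variables all forms below are summed along the fibres
  \<open>x \<mapsto> \<xi> + unit_vec n x\<close>.\<close>

lemma sum_zrp_states_Suc:
  fixes h :: "nat vec \<Rightarrow> nat \<Rightarrow> real"
  shows "(\<Sum>\<eta>\<in>zrp_states n (Suc M). \<Sum>x<n. if \<eta> $ x \<ge> 1 then h \<eta> x else 0)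
       = (\<Sum>\<xi>\<in>zrp_states n M. \<Sum>x<n. h (\<xi> + unit_vec n x) x)"
proof -
  have single_site: "(\<Sum>\<eta>\<in>zrp_states n (Suc M). if \<eta> $ x \<ge> 1 then h \<eta> x else 0)
      = (\<Sum>\<xi>\<in>zrp_states n M. h (\<xi> + unit_vec n x) x)" if x: "x < n" for x
  proof -
    have "(\<Sum>\<eta>\<in>zrp_states n (Suc M). if \<eta> $ x \<ge> 1 then h \<eta> x else 0)
        = (\<Sum>\<eta>\<in>{\<eta> \<in> zrp_states n (Suc M). \<eta> $ x \<ge> 1}. h \<eta> x)"
      by (rule sum.inter_filter[symmetric]) (rule finite_zrp_states)
    also have "\<dots> = (\<Sum>\<xi>\<in>zrp_states n M. h (\<xi> + unit_vec n x) x)"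
    proof (rule sum.reindex_bij_witness[where j = "\<lambda>\<eta>. \<eta> - unit_vec n x" and i = "\<lambda>\<xi>. \<xi> + unit_vec n x"])
      fix \<eta> assume "\<eta> \<in> {\<eta> \<in> zrp_states n (Suc M). \<eta> $ x \<ge> 1}"
      then have \<eta>: "\<eta> \<in> zrp_states n (Suc M)" "\<eta> $ x \<ge> 1" by auto
      show *: "\<eta> - unit_vec n x + unit_vec n x = \<eta>"
        using \<eta> x by (intro eq_vecI) (auto simp: zrp_states_dim)
      show "\<eta> - unit_vec n x \<in> zrp_states n M"
        using diff_unit_vec_in_zrp_states[OF \<eta>(1) x \<eta>(2)] .
      show "h (\<eta> - unit_vec n x + unit_vec n x) x = h \<eta> x" using * by simp
    next
      fix \<xi> assume \<xi>: "\<xi> \<in> zrp_states n M"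
      show "\<xi> + unit_vec n x - unit_vec n x = \<xi>"
        using \<xi> by (intro eq_vecI) (auto simp: zrp_states_dim)
      show "\<xi> + unit_vec n x \<in> {\<eta> \<in> zrp_states n (Suc M). \<eta> $ x \<ge> 1}"
        using add_unit_vec_in_zrp_states[OF \<xi> x] \<xi> x by (auto simp: zrp_states_dim)
    qed
    finally show ?thesis .
  qed
  have "(\<Sum>\<eta>\<in>zrp_states n (Suc M). \<Sum>x<n. if \<eta> $ x \<ge> 1 then h \<eta> x else 0)
      = (\<Sum>x<n. \<Sum>\<eta>\<in>zrp_states n (Suc M). if \<eta> $ x \<ge> 1 then h \<eta> x else 0)"
    by (rule sum.swap)
  also have "\<dots> = (\<Sum>x<n. \<Sum>\<xi>\<in>zrp_states n M. h (\<xi> + unit_vec n x) x)"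
    by (intro sum.cong refl single_site) simp
  also have "\<dots> = (\<Sum>\<xi>\<in>zrp_states n M. \<Sum>x<n. h (\<xi> + unit_vec n x) x)"
    by (rule sum.swap)
  finally show ?thesis .
qed

section \<open>The mean-field process\<close>

definition site_mean :: "nat \<Rightarrow> (nat \<Rightarrow> real) \<Rightarrow> real" where
  "site_mean n \<phi> = (\<Sum>y<n. \<phi> y) / n"

text \<open>The sign is chosen so that \<open>mf_gen\<close> is positive semidefinite: it is minus the generator for \<open>P(x, y) = 1 / n\<close>.\<close>

definition mf_gen :: "nat \<Rightarrow> (nat vec \<Rightarrow> real) \<Rightarrow> nat vec \<Rightarrow> real" where
  "mf_gen n f \<eta> = (\<Sum>x<n. if \<eta> $ x \<ge> 1
     then f \<eta> - site_mean n (\<lambda>y. f (\<eta> + unit_vec n y - unit_vec n x)) else 0)"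

definition mf_form :: "nat \<Rightarrow> nat \<Rightarrow> (nat vec \<Rightarrow> real) \<Rightarrow> real" where
  "mf_form n m f = (\<Sum>\<eta>\<in>zrp_states n m. f \<eta> * mf_gen n f \<eta>)"

lemma sum_centered:
  "n > 0 \<Longrightarrow> (\<Sum>x<n. \<phi> x - site_mean n \<phi>) = 0"
  by (simp add: site_mean_def sum_subtractf)

text \<open>Expanding the double sum gives the covariance. The right side is symmetric in the two
  functions, hence the self-adjointness of the mean-field operator, and it runs over pairs of sites,
  which permits pairwise estimates.\<close>

lemma sum_mult_centered:
  assumes "n > 0"
  shows "(\<Sum>x<n. \<psi> x * (\<phi> x - site_mean n \<phi>))
    = (\<Sum>x<n. \<Sum>y<n. (\<psi> x - \<psi> y) * (\<phi> x - \<phi> y)) / (2 * n)"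
proof -
  have "(\<Sum>x<n. \<Sum>y<n. (\<psi> x - \<psi> y) * (\<phi> x - \<phi> y))
    = (\<Sum>x<n. \<Sum>y<n. \<psi> x * \<phi> x + \<psi> y * \<phi> y - \<psi> x * \<phi> y - \<psi> y * \<phi> x)"
    by (intro sum.cong refl) (simp add: algebra_simps)
  also have "\<dots> = 2 * n * (\<Sum>x<n. \<psi> x * \<phi> x) - 2 * (\<Sum>x<n. \<psi> x) * (\<Sum>x<n. \<phi> x)"
    by (simp add: sum.distrib sum_subtractf sum_distrib_left[symmetric] sum_distrib_right[symmetric])
  finally have "(\<Sum>x<n. \<Sum>y<n. (\<psi> x - \<psi> y) * (\<phi> x - \<phi> y)) / (2 * n)
    = (\<Sum>x<n. \<psi> x * \<phi> x) - (\<Sum>x<n. \<psi> x) * site_mean n \<phi>"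
    using assms by (simp add: site_mean_def field_simps)
  then show ?thesis
    by (simp add: right_diff_distrib sum_subtractf sum_distrib_right)
qed

text \<open>Removing the jumping particle turns the sum over occupied sites into a sum over fibres;
  on each fibre the operator just subtracts the mean.\<close>

lemma mf_gen_pairing:
  "(\<Sum>\<eta>\<in>zrp_states n (Suc M). h \<eta> * mf_gen n f \<eta>) =
   (\<Sum>\<xi>\<in>zrp_states n M. \<Sum>x<n. h (\<xi> + unit_vec n x) *
      (f (\<xi> + unit_vec n x) - site_mean n (\<lambda>y. f (\<xi> + unit_vec n y))))"
proof -
  have "(\<Sum>\<eta>\<in>zrp_states n (Suc M). h \<eta> * mf_gen n f \<eta>)
    = (\<Sum>\<eta>\<in>zrp_states n (Suc M). \<Sum>x<n. if \<eta> $ x \<ge> 1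
     then h \<eta> * (f \<eta> - site_mean n (\<lambda>y. f (\<eta> + unit_vec n y - unit_vec n x))) else 0)"
    unfolding mf_gen_def sum_distrib_left by (intro sum.cong refl) simp
  also have "\<dots> = (\<Sum>\<xi>\<in>zrp_states n M. \<Sum>x<n. h (\<xi> + unit_vec n x) *
      (f (\<xi> + unit_vec n x) - site_mean n (\<lambda>y. f (\<xi> + unit_vec n x + unit_vec n y - unit_vec n x))))"
    by (rule sum_zrp_states_Suc)
  also have "\<dots> = (\<Sum>\<xi>\<in>zrp_states n M. \<Sum>x<n. h (\<xi> + unit_vec n x) *
      (f (\<xi> + unit_vec n x) - site_mean n (\<lambda>y. f (\<xi> + unit_vec n y))))"
    by (intro sum.cong refl) (simp add: add_diff_unit_vec)
  finally show ?thesis .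
qed

lemma mf_gen_symmetric:
  assumes "n > 0"
  shows "(\<Sum>\<eta>\<in>zrp_states n (Suc M). h \<eta> * mf_gen n f \<eta>) = (\<Sum>\<eta>\<in>zrp_states n (Suc M). f \<eta> * mf_gen n h \<eta>)"
  unfolding mf_gen_pairing sum_mult_centered[OF assms] by (simp add: mult.commute)

lemma sum_centered_sq:
  assumes "n > 0"
  shows "(\<Sum>x<n. \<phi> x * (\<phi> x - site_mean n \<phi>)) = (\<Sum>x<n. (\<phi> x - site_mean n \<phi>)\<^sup>2)"
proof -
  have "(\<Sum>x<n. (\<phi> x - site_mean n \<phi>)\<^sup>2)
    = (\<Sum>x<n. \<phi> x * (\<phi> x - site_mean n \<phi>)) - site_mean n \<phi> * (\<Sum>x<n. \<phi> x - site_mean n \<phi>)"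
    unfolding sum_distrib_left sum_subtractf[symmetric] by (intro sum.cong refl) (simp add: power2_eq_square algebra_simps)
  then show ?thesis using sum_centered[OF assms] by simp
qed

text \<open>On each fibre the form is an unnormalized variance, since a centered function is
  orthogonal to constants.\<close>

lemma mf_form_Suc:
  assumes "n > 0"
  shows "mf_form n (Suc M) f = (\<Sum>\<xi>\<in>zrp_states n M. \<Sum>x<n.
      (f (\<xi> + unit_vec n x) - site_mean n (\<lambda>y. f (\<xi> + unit_vec n y)))\<^sup>2)"
  unfolding mf_form_def mf_gen_pairing by (intro sum.cong refl sum_centered_sq assms)

text \<open>The jump rate of a site depends only on whether it is occupied. A further particle at
  \<open>x\<close> therefore changes the set of active sites only if \<open>x\<close> was empty; the
  jump that then becomes possible gives the second term.\<close>

lemma mf_gen_add_unit_vec: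
  assumes "\<xi> \<in> zrp_states n M" "x < n"
  shows "mf_gen n f (\<xi> + unit_vec n x) = mf_gen n (\<lambda>\<zeta>. f (\<zeta> + unit_vec n x)) \<xi>
    + (if \<xi> $ x = 0 then f (\<xi> + unit_vec n x) - site_mean n (\<lambda>y. f (\<xi> + unit_vec n y)) else 0)"
proof -
  let ?D = "f (\<xi> + unit_vec n x) - site_mean n (\<lambda>y. f (\<xi> + unit_vec n y))"
  have "mf_gen n f (\<xi> + unit_vec n x) = (\<Sum>z<n. (if \<xi> $ z \<ge> 1
     then f (\<xi> + unit_vec n x) - site_mean n (\<lambda>y. f (\<xi> + unit_vec n y - unit_vec n z + unit_vec n x)) else 0)
     + (if z = x then if \<xi> $ x = 0 then ?D else 0 else 0))"
    unfolding mf_gen_def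
  proof (intro sum.cong refl)
    fix z assume "z \<in> {..<n}"
    then have z: "z < n" by simp
    have [simp]: "(\<xi> + unit_vec n x) $ z = \<xi> $ z + (if z = x then 1 else 0)"
      using z assms by (auto simp: zrp_states_dim)
    show "(if 1 \<le> (\<xi> + unit_vec n x) $ z
          then f (\<xi> + unit_vec n x) - site_mean n (\<lambda>y. f (\<xi> + unit_vec n x + unit_vec n y - unit_vec n z)) else 0) =
         (if 1 \<le> \<xi> $ z
          then f (\<xi> + unit_vec n x) - site_mean n (\<lambda>y. f (\<xi> + unit_vec n y - unit_vec n z + unit_vec n x)) else 0) +
         (if z = x then if \<xi> $ x = 0 then ?D else 0 else 0)"
    proof (cases "\<xi> $ z \<ge> 1")
      case True
      then show ?thesis
        using add_unit_vec_commute_jump[OF assms(1) z True] by auto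
    next
      case False
      then show ?thesis
        using add_diff_unit_vec[OF assms] by auto
    qed
  qed
  then show ?thesis
    using assms(2) by (simp add: sum.distrib mf_gen_def)
qed

lemma site_mean_diff: "site_mean n (\<lambda>y. f y - g y) = site_mean n f - site_mean n g"
  by (simp add: site_mean_def sum_subtractf diff_divide_distrib)

lemma mf_gen_diff: "mf_gen n (\<lambda>\<eta>. f \<eta> - g \<eta>) \<eta> = mf_gen n f \<eta> - mf_gen n g \<eta>"
  unfolding mf_gen_def sum_subtractf[symmetric] by (intro sum.cong refl) (simp add: site_mean_diff)

text \<open>The term \<open>mf_gen n h \<xi> * (\<Sum>x<n. G f x \<xi>)\<close>, where \<open>h\<close> is the site mean, vanishes; this is what makes
  the identity free of a source term.\<close>

lemma mf_gen_sq_bochner: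
  assumes "n > 0"
  defines "G \<equiv> \<lambda>f x \<xi>. f (\<xi> + unit_vec n x) - site_mean n (\<lambda>y. f (\<xi> + unit_vec n y))"
  shows "(\<Sum>\<eta>\<in>zrp_states n (Suc M). (mf_gen n f \<eta>)\<^sup>2)
    = (\<Sum>x<n. mf_form n M (G f x) + (\<Sum>\<xi>\<in>zrp_states n M. if \<xi> $ x = 0 then (G f x \<xi>)\<^sup>2 else 0))"
proof -
  let ?S = "zrp_states n M"
  define h where "h = (\<lambda>\<xi>. site_mean n (\<lambda>y. f (\<xi> + unit_vec n y)))"
  have h: "G f x = (\<lambda>\<xi>. f (\<xi> + unit_vec n x) - h \<xi>)" for x by (simp add: G_def h_def)
  have "(\<Sum>\<eta>\<in>zrp_states n (Suc M). (mf_gen n f \<eta>)\<^sup>2)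
      = (\<Sum>\<xi>\<in>?S. \<Sum>x<n. mf_gen n f (\<xi> + unit_vec n x) * G f x \<xi>)"
    unfolding power2_eq_square mf_gen_pairing by (simp add: G_def)
  also have "\<dots> = (\<Sum>\<xi>\<in>?S. (\<Sum>x<n. G f x \<xi> * mf_gen n (G f x) \<xi> + (if \<xi> $ x = 0 then (G f x \<xi>)\<^sup>2 else 0)))"
  proof (rule sum.cong[OF refl])
    fix \<xi> assume \<xi>: "\<xi> \<in> ?S"
    have "(\<Sum>x<n. mf_gen n f (\<xi> + unit_vec n x) * G f x \<xi>) = 
      (\<Sum>x<n. G f x \<xi> * mf_gen n (G f x) \<xi> + (if \<xi> $ x = 0 then (G f x \<xi>)\<^sup>2 else 0) + mf_gen n h \<xi> * G f x \<xi>)"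
    proof (rule sum.cong[OF refl])
      fix x assume "x \<in> {..<n}"
      then have x: "x < n" by simp
      have "mf_gen n (G f x) \<xi> = mf_gen n (\<lambda>\<zeta>. f (\<zeta> + unit_vec n x)) \<xi> - mf_gen n h \<xi>"
        unfolding h by (rule mf_gen_diff)
      then have "mf_gen n f (\<xi> + unit_vec n x) = mf_gen n (G f x) \<xi> + mf_gen n h \<xi> + (if \<xi> $ x = 0 then G f x \<xi> else 0)"
        unfolding mf_gen_add_unit_vec[OF \<xi> x] by (simp add: G_def)
      then show "mf_gen n f (\<xi> + unit_vec n x) * G f x \<xi> = 
         G f x \<xi> * mf_gen n (G f x) \<xi> + (if \<xi> $ x = 0 then (G f x \<xi>)\<^sup>2 else 0) + mf_gen n h \<xi> * G f x \<xi>"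
        by (simp add: power2_eq_square algebra_simps)
    qed
    also have "\<dots> = (\<Sum>x<n. G f x \<xi> * mf_gen n (G f x) \<xi> + (if \<xi> $ x = 0 then (G f x \<xi>)\<^sup>2 else 0)) + mf_gen n h \<xi> * (\<Sum>x<n. G f x \<xi>)"
      by (simp add: sum.distrib sum_distrib_left)
    also have "(\<Sum>x<n. G f x \<xi>) = 0"
      unfolding G_def by (rule sum_centered[OF assms(1)])
    finally show "(\<Sum>x<n. mf_gen n f (\<xi> + unit_vec n x) * G f x \<xi>) = 
      (\<Sum>x<n. G f x \<xi> * mf_gen n (G f x) \<xi> + (if \<xi> $ x = 0 then (G f x \<xi>)\<^sup>2 else 0))" by simp
  qed
  also have "\<dots> = (\<Sum>x<n. mf_form n M (G f x) + (\<Sum>\<xi>\<in>?S. if \<xi> $ x = 0 then (G f x \<xi>)\<^sup>2 else 0))"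
    unfolding mf_form_def sum.distrib[symmetric] by (rule sum.swap)
  finally show ?thesis .
qed

section \<open>A Hardy inequality for the mean-field form\<close>

text \<open>This is the ground-state method with positive function \<open>exp (- u)\<close>, the
  exponential being replaced by its expansion to second order: the form dominates a potential built
  from the drift of \<open>u\<close> minus half of its squared gradient.\<close>

lemma mf_form_lower_bound:
  fixes u g :: "nat vec \<Rightarrow> real"
  assumes "n > 0"
  shows "mf_form n (Suc K) g \<ge> (\<Sum>\<xi>\<in>zrp_states n (Suc K). (g \<xi>)\<^sup>2 *
    (- mf_gen n u \<xi> - (\<Sum>x<n. if \<xi> $ x \<ge> 1 then site_mean n (\<lambda>y. (u (\<xi> + unit_vec n y - unit_vec n x) - u \<xi>)\<^sup>2) else 0) / 2))"
proof -
  let ?S = "zrp_states n K"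
  let ?g = "\<lambda>\<zeta> x. g (\<zeta> + unit_vec n x)" and ?u = "\<lambda>\<zeta> x. u (\<zeta> + unit_vec n x)"
  have "(\<Sum>\<xi>\<in>zrp_states n (Suc K). (g \<xi>)\<^sup>2 *
    (- mf_gen n u \<xi> - (\<Sum>x<n. if \<xi> $ x \<ge> 1 then site_mean n (\<lambda>y. (u (\<xi> + unit_vec n y - unit_vec n x) - u \<xi>)\<^sup>2) else 0) / 2))
   = - (\<Sum>\<xi>\<in>zrp_states n (Suc K). (g \<xi>)\<^sup>2 * mf_gen n u \<xi>)
     - (\<Sum>\<xi>\<in>zrp_states n (Suc K). \<Sum>x<n. if \<xi> $ x \<ge> 1 then (g \<xi>)\<^sup>2 * site_mean n (\<lambda>y. (u (\<xi> + unit_vec n y - unit_vec n x) - u \<xi>)\<^sup>2) else 0) / 2"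
    unfolding sum_negf[symmetric] sum_divide_distrib[where A = "zrp_states n (Suc K)"] sum_subtractf[symmetric]
  proof (intro sum.cong refl)
    fix \<xi>
    let ?V = "\<lambda>x. site_mean n (\<lambda>y. (u (\<xi> + unit_vec n y - unit_vec n x) - u \<xi>)\<^sup>2)"
    have "(\<Sum>x<n. if \<xi> $ x \<ge> 1 then (g \<xi>)\<^sup>2 * ?V x else 0) = (g \<xi>)\<^sup>2 * (\<Sum>x<n. if \<xi> $ x \<ge> 1 then ?V x else 0)"
      unfolding sum_distrib_left by (intro sum.cong refl) simp
    then show "(g \<xi>)\<^sup>2 * (- mf_gen n u \<xi> - (\<Sum>x<n. if \<xi> $ x \<ge> 1 then ?V x else 0) / 2)
      = - ((g \<xi>)\<^sup>2 * mf_gen n u \<xi>) - (\<Sum>x<n. if \<xi> $ x \<ge> 1 then (g \<xi>)\<^sup>2 * ?V x else 0) / 2"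
      by (simp only:) (simp add: right_diff_distrib)
  qed
  also have "(\<Sum>\<xi>\<in>zrp_states n (Suc K). \<Sum>x<n. if \<xi> $ x \<ge> 1 then (g \<xi>)\<^sup>2 * site_mean n (\<lambda>y. (u (\<xi> + unit_vec n y - unit_vec n x) - u \<xi>)\<^sup>2) else 0)
    = (\<Sum>\<zeta>\<in>?S. \<Sum>x<n. (?g \<zeta> x)\<^sup>2 * site_mean n (\<lambda>y. (?u \<zeta> y - ?u \<zeta> x)\<^sup>2))"
    unfolding sum_zrp_states_Suc by (intro sum.cong refl) (simp add: add_diff_unit_vec)
  also have "(\<Sum>\<xi>\<in>zrp_states n (Suc K). (g \<xi>)\<^sup>2 * mf_gen n u \<xi>)
    = (\<Sum>\<zeta>\<in>?S. \<Sum>x<n. (?g \<zeta> x)\<^sup>2 * (?u \<zeta> x - site_mean n (?u \<zeta>)))"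
    by (rule mf_gen_pairing)
  also have "- \<dots> - (\<Sum>\<zeta>\<in>?S. \<Sum>x<n. (?g \<zeta> x)\<^sup>2 * site_mean n (\<lambda>y. (?u \<zeta> y - ?u \<zeta> x)\<^sup>2)) / 2
    = (\<Sum>\<zeta>\<in>?S. - (\<Sum>x<n. (?g \<zeta> x)\<^sup>2 * (?u \<zeta> x - site_mean n (?u \<zeta>)))
        - (\<Sum>x<n. (?g \<zeta> x)\<^sup>2 * site_mean n (\<lambda>y. (?u \<zeta> y - ?u \<zeta> x)\<^sup>2)) / 2)"
    by (simp add: sum_negf sum_subtractf sum_divide_distrib)
  also have "\<dots> \<le> (\<Sum>\<zeta>\<in>?S. \<Sum>x<n. ?g \<zeta> x * (?g \<zeta> x - site_mean n (?g \<zeta>)))"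
  proof (rule sum_mono)
    fix \<zeta>
    \<comment> \<open>Exchanging \<open>x\<close> and \<open>y\<close> replaces the weight at one
      end of a pair by the average over both ends.\<close>
    have sw: "(\<Sum>x<n. \<Sum>y<n. (?g \<zeta> y)\<^sup>2 * (?u \<zeta> x - ?u \<zeta> y)\<^sup>2) = (\<Sum>x<n. \<Sum>y<n. (?g \<zeta> x)\<^sup>2 * (?u \<zeta> x - ?u \<zeta> y)\<^sup>2)"
      by (subst sum.swap) (simp add: power2_commute)
    have "(\<Sum>x<n. (?g \<zeta> x)\<^sup>2 * site_mean n (\<lambda>y. (?u \<zeta> y - ?u \<zeta> x)\<^sup>2))
       = (\<Sum>x<n. \<Sum>y<n. (?g \<zeta> x)\<^sup>2 * (?u \<zeta> x - ?u \<zeta> y)\<^sup>2) / n"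
      by (simp add: site_mean_def sum_distrib_left sum_divide_distrib power2_commute)
    also have "\<dots> = (\<Sum>x<n. \<Sum>y<n. ((?g \<zeta> x)\<^sup>2 + (?g \<zeta> y)\<^sup>2) * (?u \<zeta> x - ?u \<zeta> y)\<^sup>2) / (2 * n)"
      using sw by (simp add: distrib_right sum.distrib)
    finally have *: "(\<Sum>x<n. (?g \<zeta> x)\<^sup>2 * site_mean n (\<lambda>y. (?u \<zeta> y - ?u \<zeta> x)\<^sup>2)) = \<dots>" .
    have "- (\<Sum>x<n. (?g \<zeta> x)\<^sup>2 * (?u \<zeta> x - site_mean n (?u \<zeta>)))
        - (\<Sum>x<n. (?g \<zeta> x)\<^sup>2 * site_mean n (\<lambda>y. (?u \<zeta> y - ?u \<zeta> x)\<^sup>2)) / 2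
      = (\<Sum>x<n. \<Sum>y<n. - (((?g \<zeta> x)\<^sup>2 - (?g \<zeta> y)\<^sup>2) * (?u \<zeta> x - ?u \<zeta> y))
         - ((?g \<zeta> x)\<^sup>2 + (?g \<zeta> y)\<^sup>2) * (?u \<zeta> x - ?u \<zeta> y)\<^sup>2 / 2) / (2 * n)"
      unfolding * sum_mult_centered[OF assms]
      by (simp add: sum_subtractf sum_negf sum_divide_distrib[symmetric] diff_divide_distrib)
    also have "\<dots> \<le> (\<Sum>x<n. \<Sum>y<n. (?g \<zeta> x - ?g \<zeta> y) * (?g \<zeta> x - ?g \<zeta> y)) / (2 * n)"
    proof (intro divide_right_mono sum_mono)
      fix x y
      define a b c where "a = ?g \<zeta> x" and "b = ?g \<zeta> y" and "c = ?u \<zeta> x - ?u \<zeta> y"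
      \<comment> \<open>Completing the square in \<open>a - b\<close> produces a quarter of the
        square of \<open>a + b\<close>; the second term supplies what is missing to half of the sum
        of the two squares.\<close>
      have "0 \<le> (a - b + c * (a + b) / 2)\<^sup>2 + c\<^sup>2 * (a - b)\<^sup>2 / 4" by simp
      also have "\<dots> = (a - b) * (a - b) + (a\<^sup>2 - b\<^sup>2) * c + (a\<^sup>2 + b\<^sup>2) * c\<^sup>2 / 2"
        by (simp add: power2_eq_square field_simps)
      finally show "- (((?g \<zeta> x)\<^sup>2 - (?g \<zeta> y)\<^sup>2) * (?u \<zeta> x - ?u \<zeta> y))
         - ((?g \<zeta> x)\<^sup>2 + (?g \<zeta> y)\<^sup>2) * (?u \<zeta> x - ?u \<zeta> y)\<^sup>2 / 2 \<le> (?g \<zeta> x - ?g \<zeta> y) * (?g \<zeta> x - ?g \<zeta> y)"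
        unfolding a_def[symmetric] b_def[symmetric] c_def[symmetric] by linarith
    qed simp
    also have "\<dots> = (\<Sum>x<n. ?g \<zeta> x * (?g \<zeta> x - site_mean n (?g \<zeta>)))"
      by (rule sum_mult_centered[OF assms, symmetric])
    finally show "- (\<Sum>x<n. (?g \<zeta> x)\<^sup>2 * (?u \<zeta> x - site_mean n (?u \<zeta>)))
        - (\<Sum>x<n. (?g \<zeta> x)\<^sup>2 * site_mean n (\<lambda>y. (?u \<zeta> y - ?u \<zeta> x)\<^sup>2)) / 2
      \<le> (\<Sum>x<n. ?g \<zeta> x * (?g \<zeta> x - site_mean n (?g \<zeta>)))" .
  qed
  also have "\<dots> = mf_form n (Suc K) g"
    unfolding mf_form_def mf_gen_pairing ..
  finally show ?thesis .
qed

lemma sum_sq_add_unit_vec: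
  assumes "\<zeta> \<in> zrp_states n M" "y < n"
  shows "(\<Sum>z<n. (real ((\<zeta> + unit_vec n y) $ z))\<^sup>2) = (\<Sum>z<n. (real (\<zeta> $ z))\<^sup>2) + 2 * real (\<zeta> $ y) + 1"
proof -
  have "(\<Sum>z<n. (real ((\<zeta> + unit_vec n y) $ z))\<^sup>2)
    = (\<Sum>z<n. (real (\<zeta> $ z))\<^sup>2 + (if z = y then 2 * real (\<zeta> $ y) + 1 else 0))"
    using assms by (intro sum.cong refl) (auto simp: zrp_states_dim power2_eq_square algebra_simps)
  then show ?thesis using assms(2) by (simp add: sum.distrib)
qed

lemma sum_zrp_state: "\<xi> \<in> zrp_states n M \<Longrightarrow> (\<Sum>z<n. real (\<xi> $ z)) = real M"
  unfolding zrp_states_def of_nat_sum[symmetric] by simp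

lemma sum_sq_zrp_state_le:
  assumes "\<xi> \<in> zrp_states n M"
  shows "(\<Sum>z<n. (real (\<xi> $ z))\<^sup>2) \<le> (real M)\<^sup>2"
proof -
  have "(\<Sum>z<n. (real (\<xi> $ z))\<^sup>2) \<le> (\<Sum>z<n. real (\<xi> $ z) * real M)"
  proof (intro sum_mono)
    fix z assume "z \<in> {..<n}"
    then have "real (\<xi> $ z) \<le> real M"
      using member_le_sum[of z "{..<n}" "\<lambda>z. real (\<xi> $ z)"] sum_zrp_state[OF assms] by simp
    then show "(real (\<xi> $ z))\<^sup>2 \<le> real (\<xi> $ z) * real M"
      by (simp add: power2_eq_square mult_left_mono)
  qed
  then show ?thesis
    by (simp add: sum_distrib_right[symmetric] sum_zrp_state[OF assms] power2_eq_square)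
qed

lemma site_mean_add: "site_mean n (\<lambda>y. f y + g y) = site_mean n f + site_mean n g"
  by (simp add: site_mean_def sum.distrib add_divide_distrib)

lemma site_mean_cmult: "site_mean n (\<lambda>y. c * f y) = c * site_mean n f"
  by (simp add: site_mean_def sum_distrib_left)

lemma site_mean_const: "n > 0 \<Longrightarrow> site_mean n (\<lambda>y. c) = c"
  by (simp add: site_mean_def)

lemma site_mean_cong: "(\<And>y. y < n \<Longrightarrow> f y = g y) \<Longrightarrow> site_mean n f = site_mean n g"
  by (simp add: site_mean_def)

lemma site_mean_mono: "(\<And>y. y < n \<Longrightarrow> f y \<le> g y) \<Longrightarrow> site_mean n f \<le> site_mean n g"
  by (auto simp: site_mean_def intro!: divide_right_mono sum_mono)

lemma site_mean_indicator: "x < n \<Longrightarrow> site_mean n (\<lambda>y. of_bool (y = x)) = 1 / n"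
  by (simp add: site_mean_def of_bool_def)

text \<open>Minus the generator maps \<open>\<xi> \<mapsto> \<xi>(x\<^sub>0)\<close> to \<open>1(\<xi>(x\<^sub>0) \<ge> 1) - N(\<xi>) / n\<close>, where \<open>N\<close> counts the occupied
  sites. The quadratic term of the potential cancels the fluctuations of \<open>N\<close> exactly when
  \<open>L\<close> is the number of particles plus \<open>n - 1\<close>.\<close>

definition potential :: "nat \<Rightarrow> nat \<Rightarrow> real \<Rightarrow> real \<Rightarrow> nat vec \<Rightarrow> real" where
  "potential n x0 \<alpha> L \<xi> = \<alpha> / (2 * L) * (\<Sum>z<n. (real (\<xi> $ z))\<^sup>2) - \<alpha> * real (\<xi> $ x0)"

text \<open>Both ends of the jump arise from the configuration without the jumping particle by
  adding a particle, so the quadratic term contributes only a difference of two occupation numbers.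
  These are counted without the jumping particle, which explains \<open>of_bool (y = x)\<close> and
  the \<open>1\<close>.\<close>

lemma potential_jump:
  assumes "\<xi> \<in> zrp_states n (Suc K)" "x < n" "y < n" "\<xi> $ x \<ge> 1" "x0 < n"
  shows "potential n x0 \<alpha> L (\<xi> + unit_vec n y - unit_vec n x) - potential n x0 \<alpha> L \<xi>
    = \<alpha> * (of_bool (x = x0) - of_bool (y = x0))
      + \<alpha> / L * (real (\<xi> $ y) - of_bool (y = x) - (real (\<xi> $ x) - 1))"
proof -
  define \<zeta> where "\<zeta> = \<xi> - unit_vec n x"
  have \<zeta>: "\<zeta> \<in> zrp_states n K"
    unfolding \<zeta>_def by (rule diff_unit_vec_in_zrp_states[OF assms(1,2,4)])
  have \<xi>: "\<xi> = \<zeta> + unit_vec n x"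
    unfolding \<zeta>_def using assms by (intro eq_vecI) (auto simp: zrp_states_dim)
  have "real ((\<zeta> + unit_vec n w) $ x0) = real (\<zeta> $ x0) + of_bool (w = x0)" if "w < n" for w
    using that \<zeta> assms(5) by (auto simp: zrp_states_dim)
  then have *: "potential n x0 \<alpha> L (\<zeta> + unit_vec n w)
      = \<alpha> / (2 * L) * ((\<Sum>z<n. (real (\<zeta> $ z))\<^sup>2) + 2 * real (\<zeta> $ w) + 1) - \<alpha> * (real (\<zeta> $ x0) + of_bool (w = x0))"
    if "w < n" for w
    using that by (simp only: potential_def sum_sq_add_unit_vec[OF \<zeta> that])
  have "real (\<zeta> $ y) = real (\<xi> $ y) - of_bool (y = x)" "real (\<zeta> $ x) = real (\<xi> $ x) - 1"
    using \<zeta> assms(2,3) unfolding \<xi> by (auto simp: zrp_states_dim)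
  moreover have "\<xi> + unit_vec n y - unit_vec n x = \<zeta> + unit_vec n y"
    unfolding \<xi> by (rule add_diff_unit_vec[OF \<zeta> assms(2)])
  moreover have "potential n x0 \<alpha> L (\<zeta> + unit_vec n y) - potential n x0 \<alpha> L (\<zeta> + unit_vec n x)
     = \<alpha> * (of_bool (x = x0) - of_bool (y = x0)) + \<alpha> / L * (real (\<zeta> $ y) - real (\<zeta> $ x))"
    unfolding *[OF assms(2)] *[OF assms(3)] by (cases "L = 0") (simp_all add: field_simps)
  ultimately show ?thesis using \<xi> by metis
qed

lemma mf_gen_potential:
  assumes "\<xi> \<in> zrp_states n (Suc K)" "x0 < n"
  shows "- mf_gen n (potential n x0 \<alpha> (real (K + n))) \<xi>
    = \<alpha> * of_bool (\<xi> $ x0 \<ge> 1) - \<alpha> * (K + 1) / (K + n)"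
proof -
  let ?u = "potential n x0 \<alpha> (real (K + n))"
  let ?L = "real (K + n)"
  have n: "n > 0" using assms(2) by simp
  \<comment> \<open>The number of occupied sites is the only term of the drift that is neither
    constant nor local at \<open>x0\<close>.\<close>
  define N where "N = (\<Sum>x<n. of_bool (\<xi> $ x \<ge> 1) :: real)"
  have "- mf_gen n ?u \<xi> = (\<Sum>x<n. if \<xi> $ x \<ge> 1 then 
      site_mean n (\<lambda>y. ?u (\<xi> + unit_vec n y - unit_vec n x)) - ?u \<xi> else 0)"
    unfolding mf_gen_def sum_negf[symmetric] by (intro sum.cong) auto
  also have "\<dots> = (\<Sum>x<n. \<alpha> * of_bool (x = x0 \<and> \<xi> $ x \<ge> 1) 
      + (\<alpha> / ?L * (K / n + 1) - \<alpha> / n) * of_bool (\<xi> $ x \<ge> 1) - \<alpha> / ?L * real (\<xi> $ x))"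
  proof (intro sum.cong refl)
    fix x assume "x \<in> {..<n}"
    then have x: "x < n" by simp
    have "site_mean n (\<lambda>y. ?u (\<xi> + unit_vec n y - unit_vec n x)) - ?u \<xi> = 
      \<alpha> * (of_bool (x = x0) - 1 / n) + \<alpha> / ?L * (K / n - (real (\<xi> $ x) - 1))" if "\<xi> $ x \<ge> 1"
    proof -
      have "site_mean n (\<lambda>y. ?u (\<xi> + unit_vec n y - unit_vec n x)) - ?u \<xi>
        = site_mean n (\<lambda>y. ?u (\<xi> + unit_vec n y - unit_vec n x) - ?u \<xi>)"
        by (simp add: site_mean_diff site_mean_const[OF n])
      also have "\<dots> = site_mean n (\<lambda>y. \<alpha> * (of_bool (x = x0) - of_bool (y = x0))
      + \<alpha> / ?L * (real (\<xi> $ y) - of_bool (y = x) - (real (\<xi> $ x) - 1)))"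
        by (intro site_mean_cong potential_jump[OF assms(1) x _ that assms(2)])
      also have "\<dots> = \<alpha> * (of_bool (x = x0) - 1 / n) + \<alpha> / ?L * (site_mean n (\<lambda>y. real (\<xi> $ y)) - 1 / n - (real (\<xi> $ x) - 1))"
        by (simp only: site_mean_add site_mean_cmult site_mean_diff site_mean_const[OF n]
           site_mean_indicator[OF x] site_mean_indicator[OF assms(2)])
      \<comment> \<open>The jumping particle is not counted at its target, so \<open>K\<close> of
        the \<open>K + 1\<close> particles remain.\<close>
      also have "site_mean n (\<lambda>y. real (\<xi> $ y)) - 1 / n = K / n"
        by (simp add: site_mean_def sum_zrp_state[OF assms(1)] add_divide_distrib)
      finally show ?thesis .
    qed
    then show "(if \<xi> $ x \<ge> 1 then 
      site_mean n (\<lambda>y. ?u (\<xi> + unit_vec n y - unit_vec n x)) - ?u \<xi> else 0) = 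
      \<alpha> * of_bool (x = x0 \<and> \<xi> $ x \<ge> 1) 
      + (\<alpha> / ?L * (K / n + 1) - \<alpha> / n) * of_bool (\<xi> $ x \<ge> 1) - \<alpha> / ?L * real (\<xi> $ x)"
      by (cases "\<xi> $ x \<ge> 1") (simp_all add: algebra_simps)
  qed
  also have "\<dots> = \<alpha> * of_bool (\<xi> $ x0 \<ge> 1) + (\<alpha> / ?L * (K / n + 1) - \<alpha> / n) * N - \<alpha> / ?L * (K + 1)"
  proof -
    have "(\<Sum>x<n. of_bool (x = x0 \<and> \<xi> $ x \<ge> 1)) = (\<Sum>x<n. if x = x0 then of_bool (\<xi> $ x0 \<ge> 1) else (0::real))"
      by (intro sum.cong) auto
    then have "(\<Sum>x<n. of_bool (x = x0 \<and> \<xi> $ x \<ge> 1)) = (of_bool (\<xi> $ x0 \<ge> 1) :: real)"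
      using assms(2) by simp
    then show ?thesis
      unfolding sum_subtractf sum.distrib sum_distrib_left[symmetric] N_def sum_zrp_state[OF assms(1)]
      by simp
  qed
  also have "K / n + 1 = ?L / n"
    using n by (simp add: field_simps)
  \<comment> \<open>The coefficient of \<open>N\<close> vanishes because \<open>L\<close> is
    \<open>K + n\<close>.\<close>
  also have "\<alpha> / ?L * (?L / n) - \<alpha> / n = 0"
    using n by simp
  finally show ?thesis by simp
qed

text \<open>The square of a jump is at most twice the square of its local part plus twice that of
  its quadratic part. Summed over sites, each part contributes at most four times the square of
  \<alpha>; for the second, the squared occupation numbers sum to at most the square of
  \<open>K + 1\<close>, and \<open>K + 1 \<le> K + n\<close>.\<close>

lemma potential_gradient_bound:
  fixes \<alpha> :: real
  assumes "\<xi> \<in> zrp_states n (Suc K)" "x0 < n"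
  defines "u \<equiv> potential n x0 \<alpha> (real (K + n))"
  shows "(\<Sum>x<n. if \<xi> $ x \<ge> 1 then site_mean n (\<lambda>y. (u (\<xi> + unit_vec n y - unit_vec n x) - u \<xi>)\<^sup>2) else 0) \<le> 8 * \<alpha>\<^sup>2"
proof -
  let ?L = "real (K + n)" and ?Q = "\<Sum>z<n. (real (\<xi> $ z))\<^sup>2"
  have n: "n > 0" using assms(2) by simp
  have "(\<Sum>x<n. if \<xi> $ x \<ge> 1 then site_mean n (\<lambda>y. (u (\<xi> + unit_vec n y - unit_vec n x) - u \<xi>)\<^sup>2) else 0)
    \<le> (\<Sum>x<n. 2 * \<alpha>\<^sup>2 * (of_bool (x = x0) + 1 / n) + 2 * (\<alpha> / ?L)\<^sup>2 * (?Q / n + (real (\<xi> $ x))\<^sup>2))"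
  proof (rule sum_mono)
    fix x assume "x \<in> {..<n}"
    then have x: "x < n" by simp
    show "(if \<xi> $ x \<ge> 1 then site_mean n (\<lambda>y. (u (\<xi> + unit_vec n y - unit_vec n x) - u \<xi>)\<^sup>2) else 0)
      \<le> 2 * \<alpha>\<^sup>2 * (of_bool (x = x0) + 1 / n) + 2 * (\<alpha> / ?L)\<^sup>2 * (?Q / n + (real (\<xi> $ x))\<^sup>2)"
    proof (cases "\<xi> $ x \<ge> 1")
      case True
      have "site_mean n (\<lambda>y. (u (\<xi> + unit_vec n y - unit_vec n x) - u \<xi>)\<^sup>2)
        \<le> site_mean n (\<lambda>y. 2 * \<alpha>\<^sup>2 * (of_bool (x = x0) + of_bool (y = x0)) + 2 * (\<alpha> / ?L)\<^sup>2 * ((real (\<xi> $ y))\<^sup>2 + (real (\<xi> $ x))\<^sup>2))"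
      proof (rule site_mean_mono)
        fix y assume y: "y < n"
        define p q where "p = \<alpha> * (of_bool (x = x0) - of_bool (y = x0))"
          and "q = real (\<xi> $ y) - of_bool (y = x) - (real (\<xi> $ x) - 1)"
        have "(u (\<xi> + unit_vec n y - unit_vec n x) - u \<xi>)\<^sup>2 = (p + \<alpha> / ?L * q)\<^sup>2"
          unfolding u_def potential_jump[OF assms(1) x y True assms(2)] p_def q_def ..
        also have "\<dots> \<le> 2 * p\<^sup>2 + 2 * ((\<alpha> / ?L)\<^sup>2 * q\<^sup>2)"
          using zero_le_power2[of "p - \<alpha> / ?L * q"] unfolding power_mult_distrib[symmetric]
          by (simp add: power2_sum power2_diff)
        also have "p\<^sup>2 \<le> \<alpha>\<^sup>2 * (of_bool (x = x0) + of_bool (y = x0))"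
          unfolding p_def power_mult_distrib by (intro mult_left_mono) auto
        also have "q\<^sup>2 \<le> (real (\<xi> $ y))\<^sup>2 + (real (\<xi> $ x))\<^sup>2"
        proof (cases "y = x")
          case False
          define r where "r = real (\<xi> $ x) - 1"
          have r: "r \<ge> 0" "r \<le> real (\<xi> $ x)" using True by (auto simp: r_def)
          have "q\<^sup>2 = (real (\<xi> $ y))\<^sup>2 + r\<^sup>2 - 2 * real (\<xi> $ y) * r"
            using False by (simp add: q_def r_def[symmetric] power2_diff)
          also have "\<dots> \<le> (real (\<xi> $ y))\<^sup>2 + r\<^sup>2" using r by simp
          also have "r\<^sup>2 \<le> (real (\<xi> $ x))\<^sup>2" using r by (intro power_mono)
          finally show ?thesis by simp
        qed (simp add: q_def)
        finally show "(u (\<xi> + unit_vec n y - unit_vec n x) - u \<xi>)\<^sup>2 \<le> 2 * \<alpha>\<^sup>2 * (of_bool (x = x0) + of_bool (y = x0)) + 2 * (\<alpha> / ?L)\<^sup>2 * ((real (\<xi> $ y))\<^sup>2 + (real (\<xi> $ x))\<^sup>2)"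
          by (simp add: mult_left_mono mult.assoc)
      qed
      also have "\<dots> = 2 * \<alpha>\<^sup>2 * (of_bool (x = x0) + 1 / n) + 2 * (\<alpha> / ?L)\<^sup>2 * (site_mean n (\<lambda>y. (real (\<xi> $ y))\<^sup>2) + (real (\<xi> $ x))\<^sup>2)"
        by (simp only: site_mean_add site_mean_cmult site_mean_const[OF n] site_mean_indicator[OF assms(2)])
      finally show ?thesis using True by (simp add: site_mean_def)
    qed (auto intro!: add_nonneg_nonneg mult_nonneg_nonneg divide_nonneg_nonneg sum_nonneg)
  qed
  also have "\<dots> = 4 * \<alpha>\<^sup>2 + 4 * (\<alpha> / ?L)\<^sup>2 * ?Q"
    using n assms(2) unfolding sum.distrib sum_distrib_left[symmetric] by (simp add: of_bool_def)
  finally have *: "(\<Sum>x<n. if \<xi> $ x \<ge> 1 then site_mean n (\<lambda>y. (u (\<xi> + unit_vec n y - unit_vec n x) - u \<xi>)\<^sup>2) else 0)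
    \<le> 4 * \<alpha>\<^sup>2 + 4 * (\<alpha> / ?L)\<^sup>2 * ?Q" .
  have "(\<alpha> / ?L)\<^sup>2 * ?Q \<le> (\<alpha> / ?L)\<^sup>2 * ?L\<^sup>2"
  proof (intro mult_left_mono order.trans[OF sum_sq_zrp_state_le[OF assms(1)]] power_mono)
    show "real (Suc K) \<le> ?L" using n by simp
  qed auto
  also have "(\<alpha> / ?L)\<^sup>2 * ?L\<^sup>2 = \<alpha>\<^sup>2"
    using n by (simp add: power_divide)
  finally show ?thesis using * by simp
qed

text \<open>Here \<beta> is the probability under the uniform law that a given site is empty. The
  drift of the potential is \<open>\<alpha> * \<beta>\<close> where \<open>x0\<close> is occupied;
  where \<open>x0\<close> is empty the drift is negative, and the extra mass term pays for
  it.\<close>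

lemma mf_form_hardy:
  fixes n M :: nat
  assumes n: "n \<ge> 2" and x0: "x0 < n"
  defines "\<beta> \<equiv> real (n - 1) / real (M + n - 1)"
  shows "\<beta>\<^sup>2 / 16 * (\<Sum>\<xi>\<in>zrp_states n M. (g \<xi>)\<^sup>2)
    \<le> mf_form n M g + (\<Sum>\<xi>\<in>zrp_states n M. if \<xi> $ x0 = 0 then (g \<xi>)\<^sup>2 else 0)"
proof (cases M)
  \<comment> \<open>Without particles the form vanishes, but \<open>x0\<close> is empty and the mass
    term is the whole sum.\<close>
  case 0
  have z: "\<xi> $ x = 0" if "\<xi> \<in> zrp_states n 0" "x < n" for \<xi> x
    using that by (auto simp: zrp_states_def)
  have "mf_gen n g \<xi> = 0" if "\<xi> \<in> zrp_states n 0" for \<xi>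
    unfolding mf_gen_def using z[OF that] by (intro sum.neutral) auto
  then have "mf_form n 0 g = 0" by (simp add: mf_form_def)
  moreover have "(\<Sum>\<xi>\<in>zrp_states n 0. if \<xi> $ x0 = 0 then (g \<xi>)\<^sup>2 else 0) = (\<Sum>\<xi>\<in>zrp_states n 0. (g \<xi>)\<^sup>2)"
    using z x0 by (intro sum.cong) auto
  moreover have "\<beta> = 1" using n 0 by (simp add: \<beta>_def)
  ultimately show ?thesis unfolding 0 by (simp add: sum_nonneg)
next
  case (Suc K)
  \<comment> \<open>Half of the gradient bound is four times the square of \<alpha>, and
    \<open>\<beta> / 8\<close> maximizes \<open>\<alpha> * \<beta>\<close> minus that quantity; the
    maximum is \<open>\<beta>\<^sup>2 / 16\<close>.\<close>
  define \<alpha> where "\<alpha> = \<beta> / 8"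
  let ?u = "potential n x0 \<alpha> (real (K + n))"
  let ?\<Gamma> = "\<lambda>\<xi>. (\<Sum>x<n. if \<xi> $ x \<ge> 1 then site_mean n (\<lambda>y. (?u (\<xi> + unit_vec n y - unit_vec n x) - ?u \<xi>)\<^sup>2) else 0)"
  have \<beta>: "\<beta> = 1 - (K + 1) / (K + n)" "0 \<le> \<beta>" "\<beta> \<le> 1"
    using n unfolding \<beta>_def Suc by (auto simp: field_simps of_nat_diff)
  have "\<beta>\<^sup>2 / 16 * (\<Sum>\<xi>\<in>zrp_states n M. (g \<xi>)\<^sup>2) = (\<Sum>\<xi>\<in>zrp_states n M. (g \<xi>)\<^sup>2 * (\<beta>\<^sup>2 / 16))"
    by (simp add: sum_distrib_left mult.commute)
  also have "\<dots> \<le> (\<Sum>\<xi>\<in>zrp_states n M. (g \<xi>)\<^sup>2 * (- mf_gen n ?u \<xi> - ?\<Gamma> \<xi> / 2) + (if \<xi> $ x0 = 0 then (g \<xi>)\<^sup>2 else 0))"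
  proof (rule sum_mono)
    fix \<xi> assume "\<xi> \<in> zrp_states n M"
    then have \<xi>: "\<xi> \<in> zrp_states n (Suc K)" unfolding Suc .
    have "- mf_gen n ?u \<xi> = \<alpha> * of_bool (\<xi> $ x0 \<ge> 1) - \<alpha> * (1 - \<beta>)"
      unfolding mf_gen_potential[OF \<xi> x0] \<beta> by simp
    moreover have "?\<Gamma> \<xi> \<le> 8 * \<alpha>\<^sup>2"
      by (rule potential_gradient_bound[OF \<xi> x0])
    moreover have "\<alpha> * \<beta> = \<beta>\<^sup>2 / 8" "\<alpha>\<^sup>2 = \<beta>\<^sup>2 / 64" "\<beta>\<^sup>2 \<le> 1"
      using \<beta> by (simp_all add: \<alpha>_def power2_eq_square mult_le_one)
    moreover have "\<alpha> \<le> 1 / 8" using \<beta> by (simp add: \<alpha>_def)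
    ultimately have "\<beta>\<^sup>2 / 16 \<le> - mf_gen n ?u \<xi> - ?\<Gamma> \<xi> / 2 + (if \<xi> $ x0 = 0 then 1 else 0)"
      by (cases "\<xi> $ x0 = 0") (simp_all add: right_diff_distrib)
    from mult_left_mono[OF this, of "(g \<xi>)\<^sup>2"]
    show "(g \<xi>)\<^sup>2 * (\<beta>\<^sup>2 / 16) \<le> (g \<xi>)\<^sup>2 * (- mf_gen n ?u \<xi> - ?\<Gamma> \<xi> / 2) + (if \<xi> $ x0 = 0 then (g \<xi>)\<^sup>2 else 0)"
      by (simp add: distrib_left split: if_splits)
  qed
  also have "\<dots> \<le> mf_form n M g + (\<Sum>\<xi>\<in>zrp_states n M. if \<xi> $ x0 = 0 then (g \<xi>)\<^sup>2 else 0)"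
    unfolding sum.distrib Suc using n by (intro add_right_mono mf_form_lower_bound) simp
  finally show ?thesis .
qed

text \<open>The Hardy inequality is applied at each site \<open>x\<close> to the centered function
  of index \<open>x\<close>; the masses of these functions add up to the form of
  \<open>f\<close>.\<close>

lemma mf_gen_sq_ge_form:
  fixes n M :: nat
  assumes "n \<ge> 2"
  defines "\<beta> \<equiv> real (n - 1) / real (M + n - 1)"
  shows "\<beta>\<^sup>2 / 16 * mf_form n (Suc M) f \<le> (\<Sum>\<eta>\<in>zrp_states n (Suc M). (mf_gen n f \<eta>)\<^sup>2)"
proof -
  have n: "n > 0" using assms by simp
  let ?G = "\<lambda>x \<xi>. f (\<xi> + unit_vec n x) - site_mean n (\<lambda>y. f (\<xi> + unit_vec n y))"
  have "\<beta>\<^sup>2 / 16 * mf_form n (Suc M) f = (\<Sum>x<n. \<beta>\<^sup>2 / 16 * (\<Sum>\<xi>\<in>zrp_states n M. (?G x \<xi>)\<^sup>2))"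
    unfolding mf_form_Suc[OF n] sum_distrib_left by (rule sum.swap)
  also have "\<dots> \<le> (\<Sum>x<n. mf_form n M (?G x) + (\<Sum>\<xi>\<in>zrp_states n M. if \<xi> $ x = 0 then (?G x \<xi>)\<^sup>2 else 0))"
    unfolding \<beta>_def by (intro sum_mono mf_form_hardy assms) simp
  also have "\<dots> = (\<Sum>\<eta>\<in>zrp_states n (Suc M). (mf_gen n f \<eta>)\<^sup>2)"
    by (rule mf_gen_sq_bochner[OF n, symmetric])
  finally show ?thesis .
qed

section \<open>From the bound on the squared generator to a spectral gap\<close>

lemma sum_centered_sq_le:
  assumes "n > 0"
  shows "(\<Sum>x<n. (\<phi> x - site_mean n \<phi>)\<^sup>2) \<le> (\<Sum>x<n. (\<phi> x)\<^sup>2)"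
proof -
  have "(\<Sum>x<n. (\<phi> x - site_mean n \<phi>)\<^sup>2) = (\<Sum>x<n. (\<phi> x)\<^sup>2) - site_mean n \<phi> * (\<Sum>x<n. \<phi> x)"
    unfolding sum_centered_sq[OF assms, symmetric]
    by (simp add: right_diff_distrib sum_subtractf sum_distrib_left power2_eq_square mult.commute)
  also have "(\<Sum>x<n. \<phi> x) = n * site_mean n \<phi>"
    using assms by (simp add: site_mean_def)
  also have "(\<Sum>x<n. (\<phi> x)\<^sup>2) - site_mean n \<phi> * (n * site_mean n \<phi>) \<le> (\<Sum>x<n. (\<phi> x)\<^sup>2)"
    by (simp add: mult.left_commute)
  finally show ?thesis .
qed

text \<open>Centering contracts on each fibre, and a configuration lies on at most \<open>n\<close>
  fibres.\<close>

lemma mf_form_le: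
  assumes "n > 0"
  shows "mf_form n (Suc M) f \<le> n * (\<Sum>\<eta>\<in>zrp_states n (Suc M). (f \<eta>)\<^sup>2)"
proof -
  have "mf_form n (Suc M) f \<le> (\<Sum>\<xi>\<in>zrp_states n M. \<Sum>x<n. (f (\<xi> + unit_vec n x))\<^sup>2)"
    unfolding mf_form_Suc[OF assms] by (intro sum_mono sum_centered_sq_le assms)
  also have "\<dots> = (\<Sum>\<eta>\<in>zrp_states n (Suc M). \<Sum>x<n. if \<eta> $ x \<ge> 1 then (f \<eta>)\<^sup>2 else 0)"
    by (rule sum_zrp_states_Suc[symmetric])
  also have "\<dots> \<le> (\<Sum>\<eta>\<in>zrp_states n (Suc M). \<Sum>x<n. (f \<eta>)\<^sup>2)"
    by (intro sum_mono) simp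
  finally show ?thesis by (simp add: sum_distrib_left)
qed

lemma mf_gen_cmult: "mf_gen n (\<lambda>\<eta>. c * f \<eta>) \<eta> = c * mf_gen n f \<eta>"
  unfolding mf_gen_def sum_distrib_left by (intro sum.cong refl) (simp add: site_mean_cmult right_diff_distrib)

lemma sum_mf_gen:
  assumes "n > 0"
  shows "(\<Sum>\<eta>\<in>zrp_states n (Suc M). mf_gen n f \<eta>) = 0"
  using mf_gen_symmetric[OF assms, where M = M and f = f and h = "\<lambda>_. 1"]
  by (simp add: mf_gen_def site_mean_const[OF assms] cong: if_cong)

lemma mf_form_nonneg: "n > 0 \<Longrightarrow> mf_form n (Suc M) f \<ge> 0"
  by (simp add: mf_form_Suc sum_nonneg)

text \<open>An explicit Euler step of length \<open>1 / n\<close> for the semigroup. As the operator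
  lies between 0 and \<open>n\<close>, this step is positive semidefinite and contracting; iterating
  it replaces a spectral decomposition.\<close>

definition mf_step :: "nat \<Rightarrow> (nat vec \<Rightarrow> real) \<Rightarrow> nat vec \<Rightarrow> real" where
  "mf_step n f = (\<lambda>\<eta>. f \<eta> - 1 / n * mf_gen n f \<eta>)"

lemma mf_gen_step: "mf_gen n (mf_step n f) \<eta> = mf_gen n f \<eta> - 1 / n * mf_gen n (mf_gen n f) \<eta>"
  unfolding mf_step_def mf_gen_diff mf_gen_cmult ..

text \<open>By symmetry the first-order term is \<open>- 2 / n\<close> times the squared norm of
  \<open>mf_gen n f\<close>, and the upper bound \<open>n\<close> on the operator lets the
  second-order term cost at most half of that gain.\<close>

lemma mf_form_step:
  assumes "n > 0"
  shows "mf_form n (Suc M) (mf_step n f)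
    \<le> mf_form n (Suc M) f - 1 / n * (\<Sum>\<eta>\<in>zrp_states n (Suc M). (mf_gen n f \<eta>)\<^sup>2)"
proof -
  let ?S = "zrp_states n (Suc M)" and ?A = "mf_gen n f"
  have "mf_form n (Suc M) (mf_step n f) = (\<Sum>\<eta>\<in>?S. f \<eta> * ?A \<eta> - 1 / n * (?A \<eta>)\<^sup>2
      - 1 / n * (f \<eta> * mf_gen n ?A \<eta>) + (1 / n)\<^sup>2 * (?A \<eta> * mf_gen n ?A \<eta>))"
    unfolding mf_form_def mf_gen_step
    by (intro sum.cong refl) (simp add: mf_step_def power2_eq_square algebra_simps)
  also have "\<dots> = mf_form n (Suc M) f - 1 / n * (\<Sum>\<eta>\<in>?S. (?A \<eta>)\<^sup>2)
      - 1 / n * (\<Sum>\<eta>\<in>?S. f \<eta> * mf_gen n ?A \<eta>) + (1 / n)\<^sup>2 * mf_form n (Suc M) ?A"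
    unfolding sum.distrib sum_subtractf mf_form_def sum_distrib_left ..
  also have "(\<Sum>\<eta>\<in>?S. f \<eta> * mf_gen n ?A \<eta>) = (\<Sum>\<eta>\<in>?S. (?A \<eta>)\<^sup>2)"
    unfolding mf_gen_symmetric[OF assms, where h = f and f = ?A] power2_eq_square ..
  also have "(1 / n)\<^sup>2 * mf_form n (Suc M) ?A \<le> (1 / n)\<^sup>2 * (n * (\<Sum>\<eta>\<in>?S. (?A \<eta>)\<^sup>2))"
    by (intro mult_left_mono mf_form_le assms) simp
  also have "\<dots> = 1 / n * (\<Sum>\<eta>\<in>?S. (?A \<eta>)\<^sup>2)"
    using assms by (simp add: power2_eq_square)
  finally show ?thesis by simp
qed

lemma sum_mf_step:
  assumes "n > 0"
  shows "(\<Sum>\<eta>\<in>zrp_states n (Suc M). mf_step n f \<eta>) = (\<Sum>\<eta>\<in>zrp_states n (Suc M). f \<eta>)"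
  by (simp add: mf_step_def sum_subtractf sum_divide_distrib[symmetric] sum_mf_gen[OF assms])

text \<open>Only the nonnegative second-order term is discarded.\<close>

lemma sum_sq_mf_step:
  assumes "n > 0"
  shows "(\<Sum>\<eta>\<in>zrp_states n (Suc M). (mf_step n f \<eta>)\<^sup>2)
    \<ge> (\<Sum>\<eta>\<in>zrp_states n (Suc M). (f \<eta>)\<^sup>2) - 2 / n * mf_form n (Suc M) f"
  unfolding mf_form_def sum_distrib_left sum_subtractf[symmetric]
  by (intro sum_mono) (simp add: mf_step_def power2_diff mult.assoc)

text \<open>The constant may depend on \<open>n\<close> and \<open>M\<close>: it serves only to show
  that the norm tends to zero along an iteration. Particles are carried one by one to site 0, and
  each move changes \<open>f\<close> by at most twice the root of the form.\<close>

lemma mf_crude_poincare: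
  assumes n: "n > 0"
  obtains K where "K \<ge> 0"
    "\<And>f. (\<Sum>\<eta>\<in>zrp_states n (Suc M). f \<eta>) = 0 \<Longrightarrow>
      (\<Sum>\<eta>\<in>zrp_states n (Suc M). (f \<eta>)\<^sup>2) \<le> K * mf_form n (Suc M) f"
proof -
  let ?S = "zrp_states n (Suc M)"
  define e where "e = vec n (\<lambda>x. if x = 0 then Suc M else 0)"
  have close: "\<bar>f \<eta> - f e\<bar> \<le> 2 * (Suc M - \<eta> $ 0) * sqrt (mf_form n (Suc M) f)" if "\<eta> \<in> ?S" for f \<eta>
    using that
  proof (induction "Suc M - \<eta> $ 0" arbitrary: \<eta> rule: less_induct)
    case (less \<eta>)
    have le: "\<eta> $ 0 + (\<Sum>x\<in>{..<n} - {0}. \<eta> $ x) = Suc M"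
      using less.prems n by (subst sum.remove[symmetric]) (auto simp: zrp_states_def)
    show ?case
    proof (cases "\<exists>x\<in>{..<n} - {0}. \<eta> $ x \<ge> 1")
      case True
      then obtain x where x: "x < n" "x \<noteq> 0" "\<eta> $ x \<ge> 1" by auto
      define \<xi> where "\<xi> = \<eta> - unit_vec n x"
      have \<xi>: "\<xi> \<in> zrp_states n M"
        unfolding \<xi>_def by (rule diff_unit_vec_in_zrp_states[OF less.prems x(1,3)])
      have \<eta>: "\<eta> = \<xi> + unit_vec n x"
        unfolding \<xi>_def using less.prems x by (intro eq_vecI) (auto simp: zrp_states_dim)
      have "\<eta> $ x \<le> (\<Sum>x\<in>{..<n} - {0}. \<eta> $ x)" using x by (intro member_le_sum) auto
      then have "\<eta> $ 0 < Suc M" using le x(3) by linarith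
      moreover have "(\<xi> + unit_vec n 0) $ 0 = Suc (\<eta> $ 0)"
        unfolding \<eta> using \<xi> n x by (simp add: zrp_states_dim)
      \<comment> \<open>The number of particles away from site 0 drops by one, which drives the
        induction.\<close>
      ultimately have d: "Suc M - \<eta> $ 0 = Suc (Suc M - (\<xi> + unit_vec n 0) $ 0)" by simp
      let ?G = "\<lambda>x. f (\<xi> + unit_vec n x) - site_mean n (\<lambda>y. f (\<xi> + unit_vec n y))"
      have G: "\<bar>?G y\<bar> \<le> sqrt (mf_form n (Suc M) f)" if "y < n" for y
      proof (rule real_le_rsqrt)
        have "\<bar>?G y\<bar>\<^sup>2 \<le> (\<Sum>x<n. (?G x)\<^sup>2)"
          using that by (simp, intro member_le_sum) auto
        also have "\<dots> \<le> mf_form n (Suc M) f"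
          unfolding mf_form_Suc[OF n] using \<xi>
          by (intro member_le_sum[of \<xi> _ "\<lambda>\<xi>. \<Sum>x<n. (f (\<xi> + unit_vec n x) - site_mean n (\<lambda>y. f (\<xi> + unit_vec n y)))\<^sup>2"])
             (auto simp: finite_zrp_states sum_nonneg)
        finally show "\<bar>?G y\<bar>\<^sup>2 \<le> mf_form n (Suc M) f" .
      qed
      have "\<bar>f (\<xi> + unit_vec n 0) - f e\<bar> \<le> 2 * (Suc M - (\<xi> + unit_vec n 0) $ 0) * sqrt (mf_form n (Suc M) f)"
        using d by (intro less.hyps add_unit_vec_in_zrp_states \<xi> n) simp
      moreover have "\<bar>f \<eta> - f (\<xi> + unit_vec n 0)\<bar> \<le> 2 * sqrt (mf_form n (Suc M) f)"
        using G[OF x(1)] G[OF n] unfolding \<eta> by linarith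
      ultimately show ?thesis unfolding d by (simp add: algebra_simps)
    next
      case False
      then have z: "\<eta> $ x = 0" if "x < n" "x \<noteq> 0" for x
        using that False by (metis Diff_iff lessThan_iff singletonD less_one not_le)
      then have "\<eta> $ 0 = Suc M" using le by simp
      then have "\<eta> = e"
        using less.prems z unfolding e_def by (intro eq_vecI) (auto simp: zrp_states_dim)
      then show ?thesis using mf_form_nonneg[OF n, of M f] by simp
    qed
  qed
  define K where "K = real (card ?S) * (2 * Suc M)\<^sup>2"
  have "(\<Sum>\<eta>\<in>?S. (f \<eta>)\<^sup>2) \<le> K * mf_form n (Suc M) f" if f: "(\<Sum>\<eta>\<in>?S. f \<eta>) = 0" for f
  proof -
    \<comment> \<open>Since \<open>f\<close> has sum zero, subtracting the constant
      \<open>f e\<close> can only increase the sum of squares.\<close>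
    have "(\<Sum>\<eta>\<in>?S. (f \<eta>)\<^sup>2) \<le> (\<Sum>\<eta>\<in>?S. (f \<eta>)\<^sup>2) - 2 * f e * (\<Sum>\<eta>\<in>?S. f \<eta>) + card ?S * (f e)\<^sup>2"
      using f by simp
    also have "\<dots> = (\<Sum>\<eta>\<in>?S. (f \<eta> - f e)\<^sup>2)"
      by (simp add: power2_diff sum.distrib sum_subtractf sum_distrib_left mult_ac)
    also have "\<dots> \<le> (\<Sum>\<eta>\<in>?S. (2 * Suc M)\<^sup>2 * mf_form n (Suc M) f)"
    proof (rule sum_mono)
      fix \<eta> assume "\<eta> \<in> ?S"
      from close[OF this, of f]
      have "\<bar>f \<eta> - f e\<bar> \<le> 2 * (Suc M - \<eta> $ 0) * sqrt (mf_form n (Suc M) f)" .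
      also have "\<dots> \<le> 2 * Suc M * sqrt (mf_form n (Suc M) f)"
        using mf_form_nonneg[OF n, of M f] by (intro mult_right_mono) auto
      finally have "\<bar>f \<eta> - f e\<bar>\<^sup>2 \<le> (2 * Suc M * sqrt (mf_form n (Suc M) f))\<^sup>2"
        by (intro power_mono) auto
      then show "(f \<eta> - f e)\<^sup>2 \<le> (2 * Suc M)\<^sup>2 * mf_form n (Suc M) f"
        using mf_form_nonneg[OF n, of M f] by (simp add: power_mult_distrib)
    qed
    finally show ?thesis by (simp add: K_def)
  qed
  moreover have "K \<ge> 0" by (simp add: K_def)
  ultimately show ?thesis using that by blast
qed

text \<open>Along the iteration of \<open>mf_step\<close>, the quantity \<open>\<parallel>f\<parallel>\<^sup>2 - 2 / \<gamma> * D(f)\<close> does not decrease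
  while \<open>D(f)\<close> decays geometrically; the crude Poincare inequality makes \<open>\<parallel>f\<parallel>\<^sup>2\<close> tend to zero as well.\<close>

lemma mf_poincare_from_bochner:
  assumes n: "n > 0" and \<gamma>: "0 < \<gamma>" "\<gamma> \<le> n"
    and bochner: "\<And>f. \<gamma> * mf_form n (Suc M) f \<le> (\<Sum>\<eta>\<in>zrp_states n (Suc M). (mf_gen n f \<eta>)\<^sup>2)"
    and f: "(\<Sum>\<eta>\<in>zrp_states n (Suc M). f \<eta>) = 0"
  shows "(\<Sum>\<eta>\<in>zrp_states n (Suc M). (f \<eta>)\<^sup>2) \<le> 2 / \<gamma> * mf_form n (Suc M) f"
proof -
  let ?S = "zrp_states n (Suc M)" and ?D = "mf_form n (Suc M)"
  let ?N = "\<lambda>f. \<Sum>\<eta>\<in>?S. (f \<eta>)\<^sup>2"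
  define q where "q = 1 - \<gamma> / n"
  have q: "0 \<le> q" "q < 1" using n \<gamma> by (auto simp: q_def)
  have step: "?D (mf_step n g) \<le> q * ?D g" for g
  proof -
    have "1 / n * (\<gamma> * ?D g) \<le> 1 / n * (\<Sum>\<eta>\<in>?S. (mf_gen n g \<eta>)\<^sup>2)"
      by (intro mult_left_mono bochner) simp
    then show ?thesis
      using mf_form_step[OF n, of M g] by (simp add: q_def algebra_simps)
  qed
  have iter: "(\<Sum>\<eta>\<in>?S. (mf_step n ^^ k) f \<eta>) = 0 \<and> ?D ((mf_step n ^^ k) f) \<le> q ^ k * ?D f \<and>
      ?N f - 2 / \<gamma> * ?D f \<le> ?N ((mf_step n ^^ k) f) - 2 / \<gamma> * ?D ((mf_step n ^^ k) f)" for k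
  proof (induction k)
    case (Suc k)
    let ?g = "(mf_step n ^^ k) f"
    have "?D (mf_step n ?g) \<le> q * ?D ?g" by (rule step)
    also have "\<dots> \<le> q * (q ^ k * ?D f)" using Suc q by (intro mult_left_mono) auto
    finally have 1: "?D (mf_step n ?g) \<le> q ^ Suc k * ?D f" by (simp add: mult.assoc)
    have "2 / \<gamma> * ?D (mf_step n ?g) \<le> 2 / \<gamma> * (q * ?D ?g)"
      using \<gamma> by (intro mult_left_mono step) simp
    \<comment> \<open>The weight \<open>2 / \<gamma>\<close> is chosen so that the decrease of the
      form pays exactly for the loss \<open>2 / n * D\<close> of squared norm in one step.\<close>
    also have "\<dots> = 2 / \<gamma> * ?D ?g - 2 / n * ?D ?g"
      using \<gamma> n by (simp add: q_def field_simps)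
    finally have "?N ?g - 2 / \<gamma> * ?D ?g \<le> ?N (mf_step n ?g) - 2 / \<gamma> * ?D (mf_step n ?g)"
      using sum_sq_mf_step[OF n, where M = M and f = ?g] by linarith
    then show ?case using 1 Suc sum_mf_step[OF n, where M = M and f = ?g] by auto
  qed (simp add: f)
  obtain K where K: "K \<ge> 0" "\<And>f. (\<Sum>\<eta>\<in>?S. f \<eta>) = 0 \<Longrightarrow> ?N f \<le> K * ?D f"
    using mf_crude_poincare[OF n, of M] by blast
  have "?N f - 2 / \<gamma> * ?D f \<le> K * (q ^ k * ?D f)" for k
  proof -
    let ?g = "(mf_step n ^^ k) f"
    have "?N f - 2 / \<gamma> * ?D f \<le> ?N ?g - 2 / \<gamma> * ?D ?g" using iter by blast
    also have "\<dots> \<le> ?N ?g" using \<gamma> mf_form_nonneg[OF n, of M ?g] by simp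
    also have "\<dots> \<le> K * ?D ?g" using iter K(2) by blast
    also have "\<dots> \<le> K * (q ^ k * ?D f)" using iter K(1) by (intro mult_left_mono) auto
    finally show ?thesis .
  qed
  moreover have "(\<lambda>k. K * (q ^ k * ?D f)) \<longlonglongrightarrow> K * (0 * ?D f)"
    by (intro tendsto_mult tendsto_const LIMSEQ_realpow_zero q)
  ultimately have "?N f - 2 / \<gamma> * ?D f \<le> K * (0 * ?D f)"
    by (intro LIMSEQ_le_const) auto
  then show ?thesis by simp
qed

lemma mf_poincare:
  assumes "n \<ge> 2" and "(\<Sum>\<eta>\<in>zrp_states n (Suc M). f \<eta>) = 0"
  defines "\<beta> \<equiv> real (n - 1) / real (M + n - 1)"
  shows "\<beta>\<^sup>2 / 32 * (\<Sum>\<eta>\<in>zrp_states n (Suc M). (f \<eta>)\<^sup>2) \<le> mf_form n (Suc M) f"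
proof -
  have \<beta>: "0 < \<beta>" "\<beta> \<le> 1" using assms(1) by (auto simp: \<beta>_def)
  have "(\<Sum>\<eta>\<in>zrp_states n (Suc M). (f \<eta>)\<^sup>2) \<le> 2 / (\<beta>\<^sup>2 / 16) * mf_form n (Suc M) f"
  proof (rule mf_poincare_from_bochner)
    have "\<beta>\<^sup>2 / 16 \<le> 1" using \<beta> power_le_one[of \<beta> 2] by simp
    then show "\<beta>\<^sup>2 / 16 \<le> n" using assms(1) by linarith
    show "\<beta>\<^sup>2 / 16 * mf_form n (Suc M) g \<le> (\<Sum>\<eta>\<in>zrp_states n (Suc M). (mf_gen n g \<eta>)\<^sup>2)" for g
      unfolding \<beta>_def by (rule mf_gen_sq_ge_form[OF assms(1)])
  qed (use assms \<beta> in auto)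
  then show ?thesis using \<beta> by (simp add: field_simps)
qed

section \<open>Comparison of the zero-range process with the single-particle chain\<close>

lemma variance_pmf_of_set:
  fixes f :: "'s \<Rightarrow> real"
  assumes "finite S" "S \<noteq> {}"
  shows "measure_pmf.variance (pmf_of_set S) f = (\<Sum>s\<in>S. (f s - (\<Sum>s\<in>S. f s) / card S)\<^sup>2) / card S"
  by (simp add: integral_pmf_of_set assms)

lemma variance_pmf_of_set_pos:
  fixes f :: "'s \<Rightarrow> real"
  assumes "finite S" "S \<noteq> {}" "\<not> f constant_on S"
  shows "measure_pmf.variance (pmf_of_set S) f > 0"
proof -
  let ?c = "(\<Sum>s\<in>S. f s) / card S"
  obtain s where "s \<in> S" "f s \<noteq> ?c"
    using assms(3) unfolding constant_on_def by blast
  then have "(\<Sum>s\<in>S. (f s - ?c)\<^sup>2) > 0"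
    using assms by (intro sum_pos2[of _ s]) auto
  then show ?thesis
    unfolding variance_pmf_of_set[OF assms(1,2)] using assms by (simp add: card_gt_0_iff)
qed

text \<open>Nonnegativity of the form bounds the quotients below, as a real infimum
  requires.\<close>

lemma poincare_constant_le:
  assumes "finite S" "S \<noteq> {}" "\<And>g. E g g \<ge> 0" "\<not> f constant_on S"
  shows "poincare_constant S (pmf_of_set S) E \<le> E f f / measure_pmf.variance (pmf_of_set S) f"
  unfolding poincare_constant_def
proof (rule cINF_lower)
  show "bdd_below ((\<lambda>f. E f f / measure_pmf.variance (pmf_of_set S) f) ` {f. \<not> f constant_on S})"
    using assms(3) variance_pmf_of_set_pos[OF assms(1,2)]
    by (intro bdd_belowI2[of _ 0] divide_nonneg_pos) auto
qed (use assms(4) in simp)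

lemma poincare_constant_ge:
  assumes "finite S" "s \<in> S" "t \<in> S" "s \<noteq> t"
    and "\<And>f. \<not> f constant_on S \<Longrightarrow> c * measure_pmf.variance (pmf_of_set S) f \<le> E f f"
  shows "c \<le> poincare_constant S (pmf_of_set S) E"
  unfolding poincare_constant_def
proof (rule cINF_greatest)
  \<comment> \<open>Two distinct states yield a non-constant function, so the infimum is over a
    nonempty set.\<close>
  have "\<not> (\<lambda>x. of_bool (x = s) :: real) constant_on S"
    using assms(2-4) unfolding constant_on_def by (metis of_bool_eq(1,2) zero_neq_one)
  then show "{f. \<not> (f :: 'a \<Rightarrow> real) constant_on S} \<noteq> {}" by blast
next
  fix f :: "'a \<Rightarrow> real" assume f: "f \<in> {f. \<not> f constant_on S}"
  then have "measure_pmf.variance (pmf_of_set S) f > 0"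
    using assms by (intro variance_pmf_of_set_pos) auto
  then show "c \<le> E f f / measure_pmf.variance (pmf_of_set S) f"
    using assms(5)[of f] f by (simp add: pos_le_divide_eq)
qed

lemma chain_dirichlet_eq:
  assumes "n > 0" "P \<in> carrier_mat n n"
  shows "chain_dirichlet n P \<phi> \<psi> = (\<Sum>x<n. \<phi> x * (\<psi> x - (\<Sum>y<n. P $$ (x, y) * \<psi> y))) / n"
proof -
  have "((1\<^sub>m n - P) *\<^sub>v vec n \<psi>) $ x = \<psi> x - (\<Sum>y<n. P $$ (x, y) * \<psi> y)" if "x < n" for x
  proof -
    have "((1\<^sub>m n - P) *\<^sub>v vec n \<psi>) $ x = (\<Sum>y<n. (of_bool (x = y) - P $$ (x, y)) * \<psi> y)"
      using that assms by (auto simp: scalar_prod_def lessThan_atLeast0 intro!: sum.cong)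
    also have "\<dots> = (\<Sum>y<n. (if x = y then \<psi> y else 0) - P $$ (x, y) * \<psi> y)"
      by (intro sum.cong) (auto simp: algebra_simps)
    also have "\<dots> = \<psi> x - (\<Sum>y<n. P $$ (x, y) * \<psi> y)"
      using that by (simp add: sum_subtractf)
    finally show ?thesis .
  qed
  moreover have "pmf (chain_law n) x = 1 / n" if "x < n" for x
    using that assms(1) unfolding chain_law_def by (subst pmf_of_set) auto
  ultimately show ?thesis
    unfolding chain_dirichlet_def sum_divide_distrib by (intro sum.cong) auto
qed

text \<open>Row sums evaluate the squares at \<open>x\<close> and column sums those at
  \<open>y\<close>. The quadratic form thus sees only the symmetric part of
  \<open>P\<close>.\<close>

lemma chain_dirichlet_sq:
  assumes "n > 0" "doubly_stochastic n P"
  shows "chain_dirichlet n P \<phi> \<phi> = (\<Sum>x<n. \<Sum>y<n. P $$ (x, y) * (\<phi> x - \<phi> y)\<^sup>2) / (2 * n)"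
proof -
  have P: "P \<in> carrier_mat n n" "\<And>x. x < n \<Longrightarrow> (\<Sum>y<n. P $$ (x, y)) = 1" "\<And>y. y < n \<Longrightarrow> (\<Sum>x<n. P $$ (x, y)) = 1"
    using assms(2) by (auto simp: doubly_stochastic_def)
  have "(\<Sum>x<n. \<Sum>y<n. P $$ (x, y) * (\<phi> x - \<phi> y)\<^sup>2)
    = (\<Sum>x<n. \<Sum>y<n. P $$ (x, y) * (\<phi> x)\<^sup>2) + (\<Sum>x<n. \<Sum>y<n. P $$ (x, y) * (\<phi> y)\<^sup>2)
      - 2 * (\<Sum>x<n. \<Sum>y<n. \<phi> x * (P $$ (x, y) * \<phi> y))"
    unfolding sum_distrib_left sum.distrib[symmetric] sum_subtractf[symmetric]
    by (intro sum.cong refl) (simp add: power2_diff algebra_simps)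
  also have "(\<Sum>x<n. \<Sum>y<n. P $$ (x, y) * (\<phi> x)\<^sup>2) = (\<Sum>x<n. (\<phi> x)\<^sup>2)"
    unfolding sum_distrib_right[symmetric] using P by (intro sum.cong) auto
  also have "(\<Sum>x<n. \<Sum>y<n. P $$ (x, y) * (\<phi> y)\<^sup>2) = (\<Sum>y<n. (\<phi> y)\<^sup>2)"
    by (subst sum.swap, unfold sum_distrib_right[symmetric]) (use P in \<open>intro sum.cong, auto\<close>)
  finally have "(\<Sum>x<n. \<Sum>y<n. P $$ (x, y) * (\<phi> x - \<phi> y)\<^sup>2)
    = 2 * ((\<Sum>x<n. (\<phi> x)\<^sup>2) - (\<Sum>x<n. \<Sum>y<n. \<phi> x * (P $$ (x, y) * \<phi> y)))"
    by simp
  moreover have "(\<Sum>x<n. (\<phi> x)\<^sup>2) - (\<Sum>x<n. \<Sum>y<n. \<phi> x * (P $$ (x, y) * \<phi> y))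
    = (\<Sum>x<n. \<phi> x * (\<phi> x - (\<Sum>y<n. P $$ (x, y) * \<phi> y)))"
    by (simp add: right_diff_distrib sum_subtractf sum_distrib_left power2_eq_square)
  ultimately show ?thesis
    unfolding chain_dirichlet_eq[OF assms(1) P(1)] by simp
qed

lemma chain_dirichlet_nonneg:
  assumes "n > 0" "doubly_stochastic n P"
  shows "chain_dirichlet n P \<phi> \<phi> \<ge> 0"
  using assms unfolding chain_dirichlet_sq[OF assms]
  by (intro divide_nonneg_nonneg sum_nonneg mult_nonneg_nonneg) (auto simp: doubly_stochastic_def)

lemma variance_chain_law:
  assumes "n > 0"
  shows "n * measure_pmf.variance (chain_law n) \<phi> = (\<Sum>x<n. (\<phi> x - site_mean n \<phi>)\<^sup>2)"
proof -
  have "measure_pmf.variance (chain_law n) \<phi> = (\<Sum>x<n. (\<phi> x - site_mean n \<phi>)\<^sup>2) / n"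
    unfolding chain_law_def using assms variance_pmf_of_set[of "{..<n}" \<phi>]
    by (auto simp: site_mean_def)
  then show ?thesis using assms by simp
qed

lemma chain_poincare_nonneg:
  assumes "n \<ge> 2" "doubly_stochastic n P"
  shows "chain_poincare n P \<ge> 0"
  unfolding chain_poincare_def chain_law_def
  using assms chain_dirichlet_nonneg[OF _ assms(2)] 
  by (intro poincare_constant_ge[of _ 0 1]) auto

text \<open>Constant functions are included, since a fibre of a non-constant function of
  configurations may well be constant.\<close>

lemma chain_poincare_inequality:
  assumes "n > 0" "doubly_stochastic n P"
  shows "chain_poincare n P * measure_pmf.variance (chain_law n) \<phi> \<le> chain_dirichlet n P \<phi> \<phi>"
proof (cases "\<phi> constant_on {..<n}")
  case True
  then obtain c where c: "\<And>x. x < n \<Longrightarrow> \<phi> x = c" by (auto simp: constant_on_def)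
  then have "site_mean n \<phi> = c"
    using assms(1) by (simp add: site_mean_def)
  then have "n * measure_pmf.variance (chain_law n) \<phi> = 0"
    unfolding variance_chain_law[OF assms(1)] using c by simp
  then show ?thesis using chain_dirichlet_nonneg[OF assms] assms(1) by simp
next
  case False
  then have "measure_pmf.variance (chain_law n) \<phi> > 0"
    unfolding chain_law_def using assms(1) by (intro variance_pmf_of_set_pos) auto
  moreover have "chain_poincare n P \<le> chain_dirichlet n P \<phi> \<phi> / measure_pmf.variance (chain_law n) \<phi>"
    unfolding chain_poincare_def chain_law_def using assms False
    by (intro poincare_constant_le chain_dirichlet_nonneg) auto
  ultimately show ?thesis by (simp add: pos_le_divide_eq)
qed

text \<open>Removing the jumping particle leaves on each fibre the generator of a single particle.
  The factor \<open>n\<close> undoes the weight \<open>1 / n\<close> of the uniform law on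
  sites.\<close>

lemma zrp_dirichlet_eq:
  assumes n: "n > 0" and P: "doubly_stochastic n P"
  shows "zrp_dirichlet n P (Suc M) f g = n / card (zrp_states n (Suc M)) *
    (\<Sum>\<xi>\<in>zrp_states n M. chain_dirichlet n P (\<lambda>x. f (\<xi> + unit_vec n x)) (\<lambda>x. g (\<xi> + unit_vec n x)))"
proof -
  let ?S = "zrp_states n (Suc M)"
  have P': "P \<in> carrier_mat n n" "\<And>x. x < n \<Longrightarrow> (\<Sum>y<n. P $$ (x, y)) = 1"
    using P by (auto simp: doubly_stochastic_def)
  have S: "finite ?S" "?S \<noteq> {}" using n finite_zrp_states zrp_states_nonempty by auto
  have "zrp_dirichlet n P (Suc M) f g = (\<Sum>\<eta>\<in>?S. \<Sum>x<n. if \<eta> $ x \<ge> 1 then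
      f \<eta> * (\<Sum>y<n. P $$ (x, y) * (g \<eta> - g (\<eta> + unit_vec n y - unit_vec n x))) else 0) / card ?S"
    unfolding zrp_dirichlet_def sum_negf[symmetric] sum_divide_distrib zrp_law_def
  proof (intro sum.cong refl)
    fix \<eta> assume "\<eta> \<in> ?S"
    have gen: "- zrp_generator n P g \<eta> = (\<Sum>x<n. if \<eta> $ x \<ge> 1 then
      (\<Sum>y<n. P $$ (x, y) * (g \<eta> - g (\<eta> + unit_vec n y - unit_vec n x))) else 0)"
      unfolding zrp_generator_def sum.cartesian_product[symmetric] sum_negf[symmetric]
      by (intro sum.cong) (auto simp: sum_negf[symmetric] algebra_simps intro!: sum.cong)
    have "- (pmf (pmf_of_set ?S) \<eta> * f \<eta> * zrp_generator n P g \<eta>) = f \<eta> * (- zrp_generator n P g \<eta>) / card ?S"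
      using S \<open>\<eta> \<in> ?S\<close> by (simp add: pmf_of_set)
    also have "\<dots> = (\<Sum>x<n. (if \<eta> $ x \<ge> 1 then
      f \<eta> * (\<Sum>y<n. P $$ (x, y) * (g \<eta> - g (\<eta> + unit_vec n y - unit_vec n x))) else 0) / card ?S)"
      unfolding gen sum_distrib_left sum_divide_distrib by (intro sum.cong refl) (simp add: sum_distrib_left sum_divide_distrib)
    finally show "- (pmf (pmf_of_set ?S) \<eta> * f \<eta> * zrp_generator n P g \<eta>) = \<dots>" .
  qed
  also have "(\<Sum>\<eta>\<in>?S. \<Sum>x<n. if \<eta> $ x \<ge> 1 then
      f \<eta> * (\<Sum>y<n. P $$ (x, y) * (g \<eta> - g (\<eta> + unit_vec n y - unit_vec n x))) else 0)
    = (\<Sum>\<xi>\<in>zrp_states n M. \<Sum>x<n. f (\<xi> + unit_vec n x) * (\<Sum>y<n. P $$ (x, y) * 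
       (g (\<xi> + unit_vec n x) - g (\<xi> + unit_vec n x + unit_vec n y - unit_vec n x))))"
    by (rule sum_zrp_states_Suc)
  also have "\<dots> = (\<Sum>\<xi>\<in>zrp_states n M. n * chain_dirichlet n P (\<lambda>x. f (\<xi> + unit_vec n x)) (\<lambda>x. g (\<xi> + unit_vec n x)))"
  proof (intro sum.cong refl)
    fix \<xi> assume \<xi>: "\<xi> \<in> zrp_states n M"
    have "(\<Sum>y<n. P $$ (x, y) * (g (\<xi> + unit_vec n x) - g (\<xi> + unit_vec n x + unit_vec n y - unit_vec n x)))
      = g (\<xi> + unit_vec n x) - (\<Sum>y<n. P $$ (x, y) * g (\<xi> + unit_vec n y))" if "x < n" for x
      using P'(2)[OF that]
      by (simp add: add_diff_unit_vec[OF \<xi> that] right_diff_distrib sum_subtractf sum_distrib_right[symmetric])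
    then show "(\<Sum>x<n. f (\<xi> + unit_vec n x) * (\<Sum>y<n. P $$ (x, y) * 
       (g (\<xi> + unit_vec n x) - g (\<xi> + unit_vec n x + unit_vec n y - unit_vec n x))))
      = n * chain_dirichlet n P (\<lambda>x. f (\<xi> + unit_vec n x)) (\<lambda>x. g (\<xi> + unit_vec n x))"
      unfolding chain_dirichlet_eq[OF n P'(1)] using n by simp
  qed
  finally show ?thesis by (simp add: sum_distrib_left[symmetric])
qed

lemma zrp_dirichlet_nonneg:
  assumes "n > 0" "doubly_stochastic n P"
  shows "zrp_dirichlet n P (Suc M) f f \<ge> 0"
  unfolding zrp_dirichlet_eq[OF assms]
  by (intro mult_nonneg_nonneg divide_nonneg_nonneg sum_nonneg chain_dirichlet_nonneg assms) auto

text \<open>The Poincare inequality of \<open>P\<close> is applied on every fibre; the fibre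
  variances, multiplied by \<open>n\<close>, add up to the mean-field form.\<close>

lemma zrp_dirichlet_ge_mf_form:
  assumes n: "n > 0" and P: "doubly_stochastic n P"
  shows "zrp_dirichlet n P (Suc M) f f \<ge> chain_poincare n P * mf_form n (Suc M) f / card (zrp_states n (Suc M))"
proof -
  let ?\<phi> = "\<lambda>\<xi> x. f (\<xi> + unit_vec n x)"
  have "chain_poincare n P * mf_form n (Suc M) f 
     = n * (\<Sum>\<xi>\<in>zrp_states n M. chain_poincare n P * measure_pmf.variance (chain_law n) (?\<phi> \<xi>))"
    unfolding mf_form_Suc[OF n] variance_chain_law[OF n, symmetric] sum_distrib_left by (simp add: mult_ac)
  also have "\<dots> \<le> n * (\<Sum>\<xi>\<in>zrp_states n M. chain_dirichlet n P (?\<phi> \<xi>) (?\<phi> \<xi>))"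
    by (intro mult_left_mono sum_mono chain_poincare_inequality assms) auto
  finally show ?thesis
    unfolding zrp_dirichlet_eq[OF assms] by (simp add: divide_right_mono)
qed

lemma zrp_states_two_elements:
  assumes "n \<ge> 2"
  obtains s t where "s \<in> zrp_states n (Suc M)" "t \<in> zrp_states n (Suc M)" "s \<noteq> t"
proof -
  obtain \<xi> where \<xi>: "\<xi> \<in> zrp_states n M" using zrp_states_nonempty[of n M] assms by auto
  have "\<xi> + unit_vec n 0 \<in> zrp_states n (Suc M)" "\<xi> + unit_vec n 1 \<in> zrp_states n (Suc M)"
    using assms by (auto intro!: add_unit_vec_in_zrp_states \<xi>)
  moreover have "(\<xi> + unit_vec n 0) $ 0 \<noteq> (\<xi> + unit_vec n 1) $ 0"
    using \<xi> assms by (simp add: zrp_states_dim)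
  ultimately show ?thesis using that by metis
qed

lemma zrp_poincare_lower:
  assumes n: "n \<ge> 2" and P: "doubly_stochastic n P"
  defines "\<beta> \<equiv> \<lambda>M. real (n - 1) / real (M + n - 1)"
  shows "(\<beta> M)\<^sup>2 / 32 * chain_poincare n P \<le> zrp_poincare n P (Suc M)"
proof -
  let ?S = "zrp_states n (Suc M)"
  have n': "n > 0" using n by simp
  have S: "finite ?S" "?S \<noteq> {}" using n finite_zrp_states zrp_states_nonempty by auto
  obtain s t where st: "s \<in> ?S" "t \<in> ?S" "s \<noteq> t" by (rule zrp_states_two_elements[OF n])
  show ?thesis unfolding zrp_poincare_def zrp_law_def
  proof (rule poincare_constant_ge[OF S(1) st])
    fix f
    define c where "c = (\<Sum>\<eta>\<in>?S. f \<eta>) / card ?S"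
    \<comment> \<open>The mean-field inequality needs sum zero, and subtracting the mean leaves the
      form unchanged.\<close>
    have "(\<beta> M)\<^sup>2 / 32 * (\<Sum>\<eta>\<in>?S. (f \<eta> - c)\<^sup>2) \<le> mf_form n (Suc M) (\<lambda>\<eta>. f \<eta> - c)"
      unfolding \<beta>_def using S by (intro mf_poincare n) (simp add: sum_subtractf c_def)
    also have "\<dots> = mf_form n (Suc M) f"
      unfolding mf_form_Suc[OF n'] by (simp add: site_mean_diff site_mean_const[OF n'])
    finally have "chain_poincare n P * ((\<beta> M)\<^sup>2 / 32 * (\<Sum>\<eta>\<in>?S. (f \<eta> - c)\<^sup>2)) / card ?S
       \<le> chain_poincare n P * mf_form n (Suc M) f / card ?S"
      by (intro divide_right_mono mult_left_mono chain_poincare_nonneg n P) auto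
    also have "\<dots> \<le> zrp_dirichlet n P (Suc M) f f"
      by (rule zrp_dirichlet_ge_mf_form[OF n' P])
    finally show "(\<beta> M)\<^sup>2 / 32 * chain_poincare n P * measure_pmf.variance (pmf_of_set ?S) f \<le> zrp_dirichlet n P (Suc M) f f"
      unfolding variance_pmf_of_set[OF S] c_def[symmetric] by (simp add: mult_ac)
  qed
qed

section \<open>Linear test functions\<close>

text \<open>Weighting each configuration by its number of particles and removing one of them gives a
  recursion in the number of particles, from which moments follow without binomial
  coefficients.\<close>

lemma sum_zrp_states_size_biased:
  fixes F :: "nat vec \<Rightarrow> real"
  shows "Suc M * (\<Sum>\<eta>\<in>zrp_states n (Suc M). F \<eta>)
   = (\<Sum>\<xi>\<in>zrp_states n M. \<Sum>x<n. (real (\<xi> $ x) + 1) * F (\<xi> + unit_vec n x))"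
proof -
  have "Suc M * (\<Sum>\<eta>\<in>zrp_states n (Suc M). F \<eta>)
    = (\<Sum>\<eta>\<in>zrp_states n (Suc M). \<Sum>x<n. if \<eta> $ x \<ge> 1 then real (\<eta> $ x) * F \<eta> else 0)"
    unfolding sum_distrib_left
  proof (intro sum.cong refl)
    fix \<eta> assume "\<eta> \<in> zrp_states n (Suc M)"
    from sum_zrp_state[OF this] have "Suc M * F \<eta> = (\<Sum>x<n. real (\<eta> $ x)) * F \<eta>" by simp
    also have "\<dots> = (\<Sum>x<n. if \<eta> $ x \<ge> 1 then real (\<eta> $ x) * F \<eta> else 0)"
      unfolding sum_distrib_right by (intro sum.cong) auto
    finally show "Suc M * F \<eta> = (\<Sum>x<n. if \<eta> $ x \<ge> 1 then real (\<eta> $ x) * F \<eta> else 0)" .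
  qed
  also have "\<dots> = (\<Sum>\<xi>\<in>zrp_states n M. \<Sum>x<n. real ((\<xi> + unit_vec n x) $ x) * F (\<xi> + unit_vec n x))"
    by (rule sum_zrp_states_Suc)
  also have "\<dots> = (\<Sum>\<xi>\<in>zrp_states n M. \<Sum>x<n. (real (\<xi> $ x) + 1) * F (\<xi> + unit_vec n x))"
    by (intro sum.cong refl) (simp add: zrp_states_dim add.commute)
  finally show ?thesis .
qed

lemma card_zrp_states_Suc:
  "Suc M * real (card (zrp_states n (Suc M))) = (M + n) * card (zrp_states n M)"
proof -
  have "Suc M * real (card (zrp_states n (Suc M))) = (\<Sum>\<xi>\<in>zrp_states n M. \<Sum>x<n. (real (\<xi> $ x) + 1))"
    using sum_zrp_states_size_biased[where F = "\<lambda>_. 1" and M = M and n = n] by simp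
  also have "\<dots> = (\<Sum>\<xi>\<in>zrp_states n M. real (M + n))"
    by (intro sum.cong refl) (simp add: sum.distrib sum_zrp_state)
  finally show ?thesis by simp
qed

definition linear_obs :: "nat \<Rightarrow> (nat \<Rightarrow> real) \<Rightarrow> nat vec \<Rightarrow> real" where
  "linear_obs n \<psi> \<eta> = (\<Sum>z<n. \<psi> z * real (\<eta> $ z))"

lemma linear_obs_add_unit_vec:
  assumes "\<xi> \<in> zrp_states n M" "x < n"
  shows "linear_obs n \<psi> (\<xi> + unit_vec n x) = linear_obs n \<psi> \<xi> + \<psi> x"
proof -
  have "linear_obs n \<psi> (\<xi> + unit_vec n x) = (\<Sum>z<n. \<psi> z * real (\<xi> $ z) + (if z = x then \<psi> x else 0))"
    unfolding linear_obs_def using assms by (intro sum.cong) (auto simp: zrp_states_dim algebra_simps)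
  then show ?thesis using assms(2) by (simp add: sum.distrib linear_obs_def)
qed

lemma linear_obs_empty: "\<eta> \<in> zrp_states n 0 \<Longrightarrow> linear_obs n \<psi> \<eta> = 0"
  by (auto simp: linear_obs_def zrp_states_def)

text \<open>Each site has mean occupation \<open>M / n\<close>. In the recursion, the coefficient
  \<open>M + n\<close> is the total weight of a fibre, and the additional 1 comes from the
  occupation numbers paired with \<psi>.\<close>

lemma sum_linear_obs:
  assumes n: "n > 0"
  shows "(\<Sum>\<eta>\<in>zrp_states n M. linear_obs n \<psi> \<eta>) = card (zrp_states n M) * (M / n * (\<Sum>x<n. \<psi> x))"
proof (induction M)
  case (Suc M)
  let ?S = "zrp_states n M" and ?s = "\<Sum>x<n. \<psi> x"
  have "Suc M * (\<Sum>\<eta>\<in>zrp_states n (Suc M). linear_obs n \<psi> \<eta>)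
    = (\<Sum>\<xi>\<in>?S. (M + n + 1) * linear_obs n \<psi> \<xi> + ?s)"
    unfolding sum_zrp_states_size_biased
  proof (intro sum.cong refl)
    fix \<xi> assume \<xi>: "\<xi> \<in> ?S"
    have "(\<Sum>x<n. (real (\<xi> $ x) + 1) * linear_obs n \<psi> (\<xi> + unit_vec n x))
      = (\<Sum>x<n. real (\<xi> $ x) * linear_obs n \<psi> \<xi> + linear_obs n \<psi> \<xi> + \<psi> x * real (\<xi> $ x) + \<psi> x)"
      by (intro sum.cong refl) (simp add: linear_obs_add_unit_vec[OF \<xi>] algebra_simps)
    also have "\<dots> = M * linear_obs n \<psi> \<xi> + n * linear_obs n \<psi> \<xi> + linear_obs n \<psi> \<xi> + ?s"
      unfolding sum.distrib sum_distrib_right[symmetric] sum_zrp_state[OF \<xi>] linear_obs_def[symmetric] by simp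
    finally show "(\<Sum>x<n. (real (\<xi> $ x) + 1) * linear_obs n \<psi> (\<xi> + unit_vec n x)) = (M + n + 1) * linear_obs n \<psi> \<xi> + ?s"
      by (simp add: algebra_simps)
  qed
  also have "\<dots> = (M + n + 1) * (card ?S * (M / n * ?s)) + card ?S * ?s"
    by (simp add: sum.distrib sum_distrib_left[symmetric] Suc.IH)
  also have "\<dots> = (M + n) * card ?S * (Suc M / n * ?s)"
    using n by (simp add: field_simps)
  also have "\<dots> = Suc M * (card (zrp_states n (Suc M)) * (Suc M / n * ?s))"
    unfolding card_zrp_states_Suc[symmetric] by simp
  finally show ?case
    by (simp only: mult_cancel_left of_nat_eq_0_iff nat.distinct simp_thms)
qed (simp add: linear_obs_empty)

lemma sum_linear_obs_sq:
  assumes n: "n > 0" and \<phi>: "(\<Sum>x<n. \<phi> x) = 0"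
  shows "(\<Sum>\<eta>\<in>zrp_states n M. (linear_obs n \<phi> \<eta>)\<^sup>2)
    = card (zrp_states n M) * (real M * (real n + real M) / (real n * (real n + 1)) * (\<Sum>x<n. (\<phi> x)\<^sup>2))"
proof (induction M)
  case (Suc M)
  let ?S = "zrp_states n M" and ?s = "\<Sum>x<n. (\<phi> x)\<^sup>2"
  let ?l = "linear_obs n \<phi>" and ?k = "linear_obs n (\<lambda>x. (\<phi> x)\<^sup>2)"
  have "Suc M * (\<Sum>\<eta>\<in>zrp_states n (Suc M). (?l \<eta>)\<^sup>2)
    = (\<Sum>\<xi>\<in>?S. (M + n + 2) * (?l \<xi>)\<^sup>2 + ?k \<xi> + ?s)"
    unfolding sum_zrp_states_size_biased
  proof (intro sum.cong refl)
    fix \<xi> assume \<xi>: "\<xi> \<in> ?S"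
    \<comment> \<open>The cross term weighted by occupation returns twice the square of the
      observable, whence \<open>M + n + 2\<close>; the unweighted cross term vanishes as \<phi> has
      sum zero.\<close>
    have "(\<Sum>x<n. (real (\<xi> $ x) + 1) * (?l (\<xi> + unit_vec n x))\<^sup>2)
      = (\<Sum>x<n. real (\<xi> $ x) * (?l \<xi>)\<^sup>2 + (?l \<xi>)\<^sup>2 + \<phi> x * real (\<xi> $ x) * (2 * ?l \<xi>) + \<phi> x * (2 * ?l \<xi>)
          + (\<phi> x)\<^sup>2 * real (\<xi> $ x) + (\<phi> x)\<^sup>2)"
      by (intro sum.cong refl) (simp add: linear_obs_add_unit_vec[OF \<xi>] power2_eq_square algebra_simps)
    also have "\<dots> = M * (?l \<xi>)\<^sup>2 + n * (?l \<xi>)\<^sup>2 + ?l \<xi> * (2 * ?l \<xi>) + ?k \<xi> + ?s"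
      unfolding sum.distrib sum_distrib_right[symmetric] sum_zrp_state[OF \<xi>] linear_obs_def[symmetric] \<phi> by simp
    finally show "(\<Sum>x<n. (real (\<xi> $ x) + 1) * (?l (\<xi> + unit_vec n x))\<^sup>2) = (M + n + 2) * (?l \<xi>)\<^sup>2 + ?k \<xi> + ?s"
      by (simp add: power2_eq_square algebra_simps)
  qed
  also have "\<dots> = (M + n + 2) * (card ?S * (real M * (real n + real M) / (real n * (real n + 1)) * ?s)) + card ?S * (M / n * ?s) + card ?S * ?s"
    by (simp add: sum.distrib sum_distrib_left[symmetric] Suc.IH sum_linear_obs[OF n] distrib_left)
  also have "\<dots> = (M + n) * card ?S * (real (Suc M) * (real n + real (Suc M)) / (real n * (real n + 1)) * ?s)"
  proof -
    have "real n + real n * real n \<noteq> 0"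
      using n by (simp add: add_nonneg_eq_0_iff)
    then have "(M + n + 2) * (real M * (real n + real M) / (real n * (real n + 1))) + M / n + 1 = (M + n) * (real (Suc M) * (real n + real (Suc M)) / (real n * (real n + 1)) )"
      using n by (simp add: divide_simps) (simp add: algebra_simps)
    from arg_cong[OF this, of "\<lambda>t. card ?S * ?s * t"] show ?thesis
      by (simp add: algebra_simps)
  qed
  also have "\<dots> = Suc M * (card (zrp_states n (Suc M)) * (real (Suc M) * (real n + real (Suc M)) / (real n * (real n + 1)) * ?s))"
    unfolding card_zrp_states_Suc[symmetric] by simp
  finally show ?case
    by (simp only: mult_cancel_left of_nat_eq_0_iff nat.distinct simp_thms)
qed (simp add: linear_obs_empty)

text \<open>On every fibre the linear observable of the centered \<phi> equals \<phi> up to a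
  constant, so its form is an explicit multiple of that of \<phi>. Its variance is also an explicit
  multiple, and \<open>r\<close> is the ratio of the two factors.\<close>

lemma zrp_poincare_upper:
  assumes n: "n \<ge> 2" and P: "doubly_stochastic n P"
  shows "zrp_poincare n P (Suc M) \<le> real n * (real n + 1) / (real (M + n) * real (n + Suc M)) * chain_poincare n P"
proof -
  let ?S = "zrp_states n (Suc M)"
  define r :: real where "r = real n * (real n + 1) / (real (M + n) * real (n + Suc M))"
  have n': "n > 0" using n by simp
  have r: "r > 0"
    unfolding r_def using n' by (intro divide_pos_pos mult_pos_pos) simp_all
  have S: "finite ?S" "?S \<noteq> {}" using n finite_zrp_states zrp_states_nonempty by auto
  then have c: "card ?S > 0" by (simp add: card_gt_0_iff)
  \<comment> \<open>Dividing by \<open>r\<close> makes the claim a lower bound on the infimum over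
    \<phi>, so no minimizer has to be exhibited.\<close>
  have "zrp_poincare n P (Suc M) / r \<le> chain_poincare n P"
    unfolding chain_poincare_def chain_law_def
  proof (rule poincare_constant_ge)
    show "0 \<in> {..<n}" "1 \<in> {..<n}" using n by auto
    fix \<phi> :: "nat \<Rightarrow> real" assume nc: "\<not> \<phi> constant_on {..<n}"
    define \<psi> where "\<psi> = (\<lambda>x. \<phi> x - site_mean n \<phi>)"
    let ?f = "linear_obs n \<psi>" and ?V = "measure_pmf.variance (chain_law n) \<phi>"
    have \<psi>: "(\<Sum>x<n. \<psi> x) = 0" unfolding \<psi>_def by (rule sum_centered[OF n'])
    have V: "?V > 0"
      unfolding chain_law_def using n' nc by (intro variance_pmf_of_set_pos) auto
    have "(\<Sum>\<eta>\<in>?S. ?f \<eta>) = 0" by (simp add: sum_linear_obs[OF n'] \<psi>)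
    then have "measure_pmf.variance (pmf_of_set ?S) ?f = (\<Sum>\<eta>\<in>?S. (?f \<eta>)\<^sup>2) / card ?S"
      unfolding variance_pmf_of_set[OF S] by simp
    also have "\<dots> = real (Suc M) * (real n + real (Suc M)) / (real n * (real n + 1)) * (\<Sum>x<n. (\<psi> x)\<^sup>2)"
      unfolding sum_linear_obs_sq[OF n' \<psi>] using c by (intro nonzero_mult_div_cancel_left) simp
    also have "(\<Sum>x<n. (\<psi> x)\<^sup>2) = n * ?V"
      unfolding variance_chain_law[OF n'] \<psi>_def ..
    finally have var: "measure_pmf.variance (pmf_of_set ?S) ?f = real (Suc M) * (real n + real (Suc M)) / (real n + 1) * ?V"
      using n' by simp
    have "chain_dirichlet n P (\<lambda>x. ?f (\<xi> + unit_vec n x)) (\<lambda>x. ?f (\<xi> + unit_vec n x)) = chain_dirichlet n P \<phi> \<phi>"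
      if "\<xi> \<in> zrp_states n M" for \<xi>
      unfolding chain_dirichlet_sq[OF n' P]
      by (intro arg_cong[where f = "\<lambda>t. t / _"] sum.cong refl) (simp add: linear_obs_add_unit_vec[OF that] \<psi>_def)
    then have "zrp_dirichlet n P (Suc M) ?f ?f = n / card ?S * (card (zrp_states n M) * chain_dirichlet n P \<phi> \<phi>)"
      unfolding zrp_dirichlet_eq[OF n' P] by simp
    also have "\<dots> = real n * real (Suc M) / real (M + n) * chain_dirichlet n P \<phi> \<phi>"
    proof -
      have "real (card (zrp_states n M)) = Suc M * real (card ?S) / (M + n)"
        unfolding card_zrp_states_Suc using n' by simp
      then show ?thesis using c by (simp add: distrib_left)
    qed
    finally have dir: "zrp_dirichlet n P (Suc M) ?f ?f = real n * real (Suc M) / real (M + n) * chain_dirichlet n P \<phi> \<phi>" .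
    have pos: "real (Suc M) * (real n + real (Suc M)) / (real n + 1) * ?V > 0"
      by (intro mult_pos_pos divide_pos_pos V) simp_all
    \<comment> \<open>A constant observable would have variance zero, against the positive value
      just computed.\<close>
    have "\<not> ?f constant_on ?S"
    proof
      assume "?f constant_on ?S"
      then obtain a where a: "\<And>\<eta>. \<eta> \<in> ?S \<Longrightarrow> ?f \<eta> = a" by (auto simp: constant_on_def)
      then have "(\<Sum>\<eta>\<in>?S. (?f \<eta> - (\<Sum>\<eta>\<in>?S. ?f \<eta>) / card ?S)\<^sup>2) = 0"
        using c by simp
      then have "measure_pmf.variance (pmf_of_set ?S) ?f = 0"
        unfolding variance_pmf_of_set[OF S] by simp
      then show False using var pos by simp
    qed
    then have "zrp_poincare n P (Suc M) \<le> zrp_dirichlet n P (Suc M) ?f ?f / measure_pmf.variance (pmf_of_set ?S) ?f"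
      unfolding zrp_poincare_def zrp_law_def
      by (intro poincare_constant_le S zrp_dirichlet_nonneg n' P)
    also have "\<dots> = r * (chain_dirichlet n P \<phi> \<phi> / ?V)"
    proof -
      have "(a * s / b * e) / (s * l / (a + 1) * v) = a * (a + 1) / (b * l) * (e / v)"
        if "s > 0" "a > 0" "b > 0" "l > 0" "v > 0" for a s b e l v :: real
        using that by (simp add: divide_simps)
      then show ?thesis
        unfolding dir var r_def of_nat_add[of n "Suc M", symmetric] using n' V by simp
    qed
    finally have "zrp_poincare n P (Suc M) / r \<le> chain_dirichlet n P \<phi> \<phi> / ?V"
      using r by (simp add: field_simps)
    then show "zrp_poincare n P (Suc M) / r * measure_pmf.variance (pmf_of_set {..<n}) \<phi> \<le> chain_dirichlet n P \<phi> \<phi>"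
      using V unfolding chain_law_def by (simp add: pos_le_divide_eq)
  qed auto
  then show ?thesis using r unfolding r_def[symmetric] by (simp add: field_simps)
qed

section \<open>Explicit constants for the two-sided bound\<close>

theorem corollary6:
  shows "\<exists>c C :: real. 0 < c \<and> c \<le> C \<and>
    (\<forall>(n::nat) (P::real mat) (m::nat).
       n \<ge> 2 \<longrightarrow> doubly_stochastic n P \<longrightarrow> irreducible_matrix n P \<longrightarrow> m \<ge> 1 \<longrightarrow>
       c * chain_poincare n P * (1 + real m / real n) powi (-2) \<le> zrp_poincare n P m \<and>
       zrp_poincare n P m \<le> C * chain_poincare n P * (1 + real m / real n) powi (-2))"
proof (rule exI[of _ "1 / 128"], rule exI[of _ "9 / 4"], intro conjI allI impI)
  fix n :: nat and P :: "real mat" and m :: nat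
  assume n: "n \<ge> 2" and P: "doubly_stochastic n P" and m: "m \<ge> 1"
  obtain M where M: "m = Suc M" using m by (cases m) auto
  define \<rho> :: real where "\<rho> = n / (n + m)"
  have "1 + real m / real n = inverse \<rho>" using n by (simp add: \<rho>_def field_simps)
  then have \<rho>: "(1 + real m / real n) powi (-2) = \<rho>\<^sup>2"
    by (simp add: power_int_minus power_inverse)
  have \<lambda>: "chain_poincare n P \<ge> 0" by (rule chain_poincare_nonneg[OF n P])
  \<comment> \<open>Here \<open>n \<le> 2 * (n - 1)\<close> costs a factor 2, and squaring it turns
    \<open>1 / 32\<close> into \<open>1 / 128\<close>.\<close>
  have "\<rho> / 2 \<le> real (n - 1) / real (M + n - 1)"
  proof -
    have "real n * (real M + real n - 1) \<le> (2 * (real n - 1)) * (real n + real m)"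
      using n M by (intro mult_mono) auto
    then have "real n / (2 * (real n + real m)) \<le> (real n - 1) / (real M + real n - 1)"
      using n by (simp add: divide_simps algebra_simps)
    then show ?thesis using n by (simp add: \<rho>_def of_nat_diff mult.commute)
  qed
  then have "(\<rho> / 2)\<^sup>2 \<le> (real (n - 1) / real (M + n - 1))\<^sup>2"
    by (intro power_mono) (simp_all add: \<rho>_def)
  then have "\<rho>\<^sup>2 / 128 * chain_poincare n P \<le> (real (n - 1) / real (M + n - 1))\<^sup>2 / 32 * chain_poincare n P"
    by (intro mult_right_mono \<lambda>) (simp add: power_divide mult.commute)
  also have "\<dots> \<le> zrp_poincare n P m"
    unfolding M by (rule zrp_poincare_lower[OF n P])
  finally show "1 / 128 * chain_poincare n P * (1 + real m / real n) powi (-2) \<le> zrp_poincare n P m"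
    unfolding \<rho> by (simp add: mult_ac)
  have "real n * (real n + 1) / (real (M + n) * real (n + Suc M)) \<le> 9 / 4 * \<rho>\<^sup>2"
  proof -
    define a b d where "a = real n" and "b = real (M + n)" and "d = real (n + m)"
    have pos: "a > 0" "b > 0" "d > 0" using n by (auto simp: a_def b_def d_def)
    \<comment> \<open>Since \<open>a\<close> and \<open>b\<close> are at least 2, both
      \<open>a + 1\<close> and \<open>d = b + 1\<close> are within a factor \<open>3 / 2\<close> of
      \<open>a\<close> and \<open>b\<close>; the product of the two factors is
      \<open>9 / 4\<close>.\<close>
    have "(2 * (a + 1)) * (2 * d) \<le> (3 * a) * (3 * b)"
      by (rule mult_mono) (use n M in \<open>auto simp: a_def b_def d_def\<close>)
    then have "(a * d) * ((2 * (a + 1)) * (2 * d)) \<le> (a * d) * ((3 * a) * (3 * b))"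
      using pos by (intro mult_left_mono) auto
    then have "a * (a + 1) / (b * d) \<le> 9 / 4 * (a / d)\<^sup>2"
      using pos by (simp add: power2_eq_square divide_simps) (simp add: algebra_simps)
    then show ?thesis
      unfolding a_def b_def d_def \<rho>_def M .
  qed
  then have "real n * (real n + 1) / (real (M + n) * real (n + Suc M)) * chain_poincare n P \<le> 9 / 4 * \<rho>\<^sup>2 * chain_poincare n P"
    by (intro mult_right_mono \<lambda>) simp
  with zrp_poincare_upper[OF n P, of M] have "zrp_poincare n P m \<le> 9 / 4 * \<rho>\<^sup>2 * chain_poincare n P"
    unfolding M by (rule order.trans)
  then show "zrp_poincare n P m \<le> 9 / 4 * chain_poincare n P * (1 + real m / real n) powi (-2)"
    unfolding \<rho> by (simp add: mult_ac)
qed simp_all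

end
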